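(* Let $P$, $\{\widehat P_k\}_{k\ge1}$, $V$, $\pi$, $\widehat\pi_k$, $\phi_k$ be as in the context. Assume that $P$ is $V$-geometrically ergodic with rate $\rho\in(0,1)$, that $\lim_k\|\widehat P_k-P\|_{0,1}=0$, and that there exist $\delta\in(0,1)$ and $L>0$ such that $PV\le\delta V+L\,1_{\mathbb X}$ and $\widehat P_kV\le\delta V+L\,1_{\mathbb X}$ for every $k\ge1$. Set $\hat\alpha:=\max(r_{ess}(P),\delta)$, $B:=\frac{L}{1-\hat\alpha}$, $A:=1+\frac{L}{1-\delta}$. Let $(r,\vartheta)\in(0,1)^2$ be such that $$\max(\hat\alpha,\rho)+\vartheta<r<1-\vartheta .$$ Define $$H:=\sup_{z\in\mathcal V(r,\vartheta,P)^c}\|(zI-P)^{-1}\|_1,\quad n_1:=\left\lfloor\frac{\ln2}{\ln(r/\hat\alpha)}\right\rfloor+1,\quad n_2:=\left\lfloor\frac{\ln\big(8B(B+3)\,r^{-n_1}H\big)}{\ln(r/\hat\alpha)}\right\rfloor+1,$$ $$\varepsilon_1:=\frac{r^{n_1+n_2}}{8B\big(HB+(1-r)^{-1}\big)},\qquad c:=\frac{4(B+1)}{r^{n_1}(1-r)}+\frac1{2\varepsilon_1}.$$ Then, for any integer $k\ge1$ such that $\|\widehat P_k-P\|_{0,1}\le\varepsilon_1$ and such that $\widehat P_k$ is $V$-geometrically ergodic with some rate $\rho_k<1-\vartheta$, the following hold. 1. For all $n\ge0$, $\ \|\widehat P_k^{\,n}-\widehat\pi_k(\cdot)\phi_k\|_1\le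 c\,r^{n+1}$. 2. With $\Delta_k:=\|\widehat P_k-P\|_{0,1}$, $$\|\widehat\pi_k-\pi\|_{TV}\ \le\ \widehat\pi_k(1_{\mathbb X})\,|1-\pi(\phi_k)|+\frac{L}{1-\delta}\left(2c+\frac{A}{\ln r^{-1}}\,|\ln\Delta_k|\right)\Delta_k .$$
   Context: Setting. $(\mathbb X,\mathcal X)$ is a measurable space and $V:\mathbb X\to[1,+\infty)$ is measurable with $V(x_0)=1$ for some $x_0\in\mathbb X$. $\mathcal B_1$ is the Banach space of measurable $f:\mathbb X\to\mathbb C$ with $\|f\|_1:=\sup_{x}|f(x)|/V(x)<\infty$; $\mathcal B_0$ is the Banach space of bounded measurable $f:\mathbb X\to\mathbb C$ with $\|f\|_0:=\sup_x|f(x)|$. For a linear map $T:\mathcal B_0\to\mathcal B_1$, $\|T\|_{0,1}:=\sup\{\|Tf\|_1: f\in\mathcal B_0,\|f\|_0\le1\}$; $\|T\|_1$ also denotes the operator norm of a bounded linear operator $T$ on $\mathcal B_1$. For a positive measure $\mu$, $\mu(f):=\int f\,d\mu$. A kernel $K$ acts by $(Kf)(x)=\int f(y)K(x,dy)$. Standing assumptions. $P$ is a Markov kernel and $\{\widehat P_k\}_{k\ge1}$ is a sequence of nonnegative sub-Markov kernels on $(\mathbb X,\mathcal X)$; $PV/V$ and each $\widehat P_kV/V$ are bounded on $\mathbb X$. $P$ has an invariant probability measure $\pi$ with $\pi(V)<\infty$; each $\widehat P_k$ has an invariant bounded positive measure $\widehat\pi_k$ with $\widehat\pi_k(V)<\infty$,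 and there is a bounded measurable $\phi_k:\mathbb X\to[0,+\infty)$ with $\widehat P_k\phi_k=\phi_k$ and $\widehat\pi_k(\phi_k)=1$. Each $\widehat P_k$ has finite rank on $\mathcal B_1$; $\lim_k\pi(\phi_k)=1$ and $\lim_k\widehat\pi_k(1_{\mathbb X})=1$. $P$ is $V$-geometrically ergodic with rate $\rho\in(0,1)$ if there is $C>0$ with $\sup_{\|f\|_1\le1}\|P^nf-\pi(f)1_{\mathbb X}\|_1\le C\rho^n$ for all $n\ge0$. $\widehat P_k$ is $V$-geometrically ergodic with rate $\rho_k\in(0,1)$ if there is $C_k>0$ with $\sup_{\|f\|_1\le1}\|\widehat P_k^{\,n}f-\widehat\pi_k(f)\phi_k\|_1\le C_k\rho_k^n$ for all $n\ge0$. $r_{ess}(P)$ is the essential spectral radius of $P$ acting on $\mathcal B_1$, i.e. $\lim_n(\inf_K\|P^n-K\|_1)^{1/n}$, infimum over compact operators $K$ on $\mathcal B_1$. For a bounded operator $T$ on $\mathcal B_1$ with spectrum $\sigma(T)$, $\mathcal V(r,\vartheta,T):=\{z\in\mathbb C:\ |z|\le r\text{ or }d(z,\sigma(T))\le\vartheta\}$ and $\mathcal V(r,\vartheta,T)^c$ is its complement in $\mathbb C$. $\lfloor\cdot\rfloor$ is the integer part. $\widehat\pi_k(\cdot)\phi_k$ is the operator $f\mapsto\widehat\pi_k(f)\phi_k$. $\|\widehat\pi_k-\pi\|_{TV}:=\sup_{\|f\|_0\le1}|\widehat\pi_k(f)-\pi(f)|$. Convention: $|\ln0|\cdot0=0$.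 *)

theory Defs
  imports "HOL-Probability.Probability"
begin

text \<open>
  The measurable space is a measure \<open>M\<close> of which only \<open>space M\<close> and \<open>sets M\<close> matter.
  The space of weight \<open>W\<close> consists of functions on \<open>space M\<close>; they are extended by \<open>0\<close>
  outside \<open>space M\<close>, so that equality of functions is equality on \<open>space M\<close> and the weighted
  norm is a norm. The weight \<open>V\<close> gives $\mathcal B_1$, the weight \<open>1\<close> gives $\mathcal B_0$.
\<close>

definition wspace :: "'a measure \<Rightarrow> ('a \<Rightarrow> real) \<Rightarrow> ('a \<Rightarrow> complex) set" where
  "wspace M W = {f \<in> borel_measurable M.
     bdd_above ((\<lambda>x. cmod (f x) / W x) ` space M) \<and> (\<forall>x. x \<notin> space M \<longrightarrow> f x = 0)}"

definition wnorm :: "'a measure \<Rightarrow> ('a \<Rightarrow> real) \<Rightarrow> ('a \<Rightarrow> complex) \<Rightarrow> real" where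
  "wnorm M W f = (SUP x\<in>space M. cmod (f x) / W x)"

text \<open>
  Norm of an operator from the space of weight \<open>U\<close> to the space of weight \<open>W\<close>. This is a real
  supremum, hence meaningful for bounded operators only.
\<close>

definition opnorm ::
  "'a measure \<Rightarrow> ('a \<Rightarrow> real) \<Rightarrow> ('a \<Rightarrow> real) \<Rightarrow> (('a \<Rightarrow> complex) \<Rightarrow> ('a \<Rightarrow> complex)) \<Rightarrow> real" where
  "opnorm M U W T = Sup {wnorm M W (T f) | f. f \<in> wspace M U \<and> wnorm M U f \<le> 1}"

abbreviation opnorm1 where "opnorm1 M V T \<equiv> opnorm M V V T"

abbreviation opnorm01 where "opnorm01 M V T \<equiv> opnorm M (\<lambda>_. 1) V T"

definition bounded_op ::
  "'a measure \<Rightarrow> ('a \<Rightarrow> real) \<Rightarrow> (('a \<Rightarrow> complex) \<Rightarrow> ('a \<Rightarrow> complex)) \<Rightarrow> bool" where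
  "bounded_op M W T \<longleftrightarrow>
     (\<forall>f\<in>wspace M W. T f \<in> wspace M W) \<and>
     (\<forall>f\<in>wspace M W. \<forall>g\<in>wspace M W. T (\<lambda>x. f x + g x) = (\<lambda>x. T f x + T g x)) \<and>
     (\<forall>a. \<forall>f\<in>wspace M W. T (\<lambda>x. a * f x) = (\<lambda>x. a * T f x)) \<and>
     (\<exists>C. \<forall>f\<in>wspace M W. wnorm M W (T f) \<le> C * wnorm M W f)"

definition wtopology :: "'a measure \<Rightarrow> ('a \<Rightarrow> real) \<Rightarrow> ('a \<Rightarrow> complex) topology" where
  "wtopology M W =
     Metric_space.mtopology (wspace M W) (\<lambda>f g. wnorm M W (\<lambda>x. f x - g x))"

definition compact_op ::
  "'a measure \<Rightarrow> ('a \<Rightarrow> real) \<Rightarrow> (('a \<Rightarrow> complex) \<Rightarrow> ('a \<Rightarrow> complex)) \<Rightarrow> bool" where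
  "compact_op M W T \<longleftrightarrow> bounded_op M W T \<and>
     compactin (wtopology M W)
       (wtopology M W closure_of (T ` {f \<in> wspace M W. wnorm M W f \<le> 1}))"

definition finite_rank_op ::
  "'a measure \<Rightarrow> ('a \<Rightarrow> real) \<Rightarrow> (('a \<Rightarrow> complex) \<Rightarrow> ('a \<Rightarrow> complex)) \<Rightarrow> bool" where
  "finite_rank_op M W T \<longleftrightarrow>
     (\<exists>F. finite F \<and> F \<subseteq> wspace M W \<and>
       (\<forall>f\<in>wspace M W. \<exists>a. T f = (\<lambda>x. \<Sum>g\<in>F. a g * g x)))"

definition ess_spectral_radius ::
  "'a measure \<Rightarrow> ('a \<Rightarrow> real) \<Rightarrow> (('a \<Rightarrow> complex) \<Rightarrow> ('a \<Rightarrow> complex)) \<Rightarrow> real" where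
  "ess_spectral_radius M W T =
     lim (\<lambda>n. root n (Inf {opnorm1 M W (\<lambda>f x. (T ^^ n) f x - K f x) | K. compact_op M W K}))"

definition spectrum ::
  "'a measure \<Rightarrow> ('a \<Rightarrow> real) \<Rightarrow> (('a \<Rightarrow> complex) \<Rightarrow> ('a \<Rightarrow> complex)) \<Rightarrow> complex set" where
  "spectrum M W T = {z. \<not> (\<exists>R. bounded_op M W R \<and>
     (\<forall>f\<in>wspace M W. R (\<lambda>x. z * f x - T f x) = f \<and> (\<lambda>x. z * R f x - T (R f) x) = f))}"

text \<open>The operator $(zI-T)^{-1}$, to be used for \<open>z\<close> outside the spectrum.\<close>

definition resolvent ::
  "'a measure \<Rightarrow> ('a \<Rightarrow> real) \<Rightarrow> (('a \<Rightarrow> complex) \<Rightarrow> ('a \<Rightarrow> complex)) \<Rightarrow>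
     complex \<Rightarrow> ('a \<Rightarrow> complex) \<Rightarrow> ('a \<Rightarrow> complex)" where
  "resolvent M W T z = inv_into (wspace M W) (\<lambda>f x. z * f x - T f x)"

definition spectral_nbhd ::
  "'a measure \<Rightarrow> ('a \<Rightarrow> real) \<Rightarrow> real \<Rightarrow> real \<Rightarrow> (('a \<Rightarrow> complex) \<Rightarrow> ('a \<Rightarrow> complex)) \<Rightarrow> complex set" where
  "spectral_nbhd M W r \<theta> T = {z. cmod z \<le> r \<or> infdist z (spectrum M W T) \<le> \<theta>}"

definition kernel_op :: "'a measure \<Rightarrow> ('a \<Rightarrow> 'a measure) \<Rightarrow> ('a \<Rightarrow> complex) \<Rightarrow> ('a \<Rightarrow> complex)" where
  "kernel_op M K f = (\<lambda>x. if x \<in> space M then (LINT y|K x. f y) else 0)"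

definition invariant_measure :: "'a measure \<Rightarrow> ('a \<Rightarrow> 'a measure) \<Rightarrow> 'a measure \<Rightarrow> bool" where
  "invariant_measure M K \<mu> \<longleftrightarrow> sets \<mu> = sets M \<and>
     (\<forall>A\<in>sets M. (\<integral>\<^sup>+ x. emeasure (K x) A \<partial>\<mu>) = emeasure \<mu> A)"

text \<open>The operator $f \mapsto \mu(f)\,\phi$, with values extended by \<open>0\<close> outside \<open>space M\<close>.\<close>

definition rank_one_op ::
  "'a measure \<Rightarrow> 'a measure \<Rightarrow> ('a \<Rightarrow> real) \<Rightarrow> ('a \<Rightarrow> complex) \<Rightarrow> ('a \<Rightarrow> complex)" where
  "rank_one_op M \<mu> \<phi> f =
     (\<lambda>x. if x \<in> space M then (LINT y|\<mu>. f y) * complex_of_real (\<phi> x) else 0)"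

text \<open>
  For the Markov kernel \<open>P\<close> this is used with \<open>\<mu> = \<pi>\<close> and \<open>\<phi> = 1\<close>, for the sub-Markov kernels
  with their own invariant measures and functions.
\<close>

definition V_geom_ergodic ::
  "'a measure \<Rightarrow> ('a \<Rightarrow> real) \<Rightarrow> ('a \<Rightarrow> 'a measure) \<Rightarrow> 'a measure \<Rightarrow> ('a \<Rightarrow> real) \<Rightarrow> real \<Rightarrow> bool" where
  "V_geom_ergodic M V K \<mu> \<phi> \<rho> \<longleftrightarrow> 0 < \<rho> \<and> \<rho> < 1 \<and>
     (\<exists>C>0. \<forall>n. opnorm1 M V (\<lambda>f x. (kernel_op M K ^^ n) f x - rank_one_op M \<mu> \<phi> f x) \<le> C * \<rho> ^ n)"

definition tv_norm_diff :: "'a measure \<Rightarrow> 'a measure \<Rightarrow> 'a measure \<Rightarrow> real" where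
  "tv_norm_diff M \<mu> \<nu> =
     Sup {cmod ((LINT x|\<mu>. f x) - (LINT x|\<nu>. f x)) | f. f \<in> wspace M (\<lambda>_. 1) \<and> wnorm M (\<lambda>_. 1) f \<le> 1}"

end

theory Submission
  imports Defs "HOL-Complex_Analysis.Cauchy_Integral_Formula"
begin

text \<open>
  Write \<open>Q\<close> for the approximating kernel and \<open>\<Delta>\<close> for its distance to \<open>P\<close>. The distance is small only
  for operators from bounded functions to \<open>V\<close>-weighted functions, so resolvents on the weighted space
  cannot be compared by a Neumann series. The remedy is the argument of Keller and Liverani, here
  applied to bounded linear functionals \<open>m\<close> on the weighted space. Such an \<open>m\<close> has a strong norm
  (supremum over \<open>\<bar>f\<bar> \<le> V\<close>) and a weak norm (supremum over \<open>\<bar>f\<bar> \<le> 1\<close>). The drift condition gives a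
  Doeblin-Fortet inequality: composing \<open>m\<close> with \<open>Q ^ n\<close> contracts the strong norm by \<open>\<delta> ^ n\<close> up to
  a multiple of the weak norm (\<open>Doeblin_Fortet\<close>), whereas the weak norm of \<open>m \<circ> (Q - P)\<close> is at most
  \<open>\<Delta>\<close> times the strong norm of \<open>m\<close>. Playing the two norms against each other, with \<open>n1\<close> iterations of
  \<open>Q\<close> and \<open>n2\<close> iterations of \<open>P\<close>, bounds the strong norm of \<open>m\<close> by \<open>c\<close> times that of \<open>m \<circ> (z - Q)\<close>
  (\<open>functional_perturbation_bound\<close>). The constant \<open>c\<close> is the same for all \<open>z\<close> in the annulus
  \<open>r < \<bar>z\<bar> < 1 - \<theta>\<close>; this annulus avoids the \<open>\<theta>\<close>-neighbourhood of the spectrum of \<open>P\<close>, because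
  geometric ergodicity confines that spectrum to the point 1 and a disc of radius \<open>\<rho>\<close>
  (\<open>not_in_spectral_nbhd\<close>).

  The bound on functionals is turned into a rate as follows. Let \<open>a n\<close> be the value at \<open>f\<close> and \<open>x\<close> of
  \<open>Q ^ n\<close> minus its limiting projection, and suppose it is known to be \<open>O(t ^ n)\<close>. For \<open>\<bar>z\<bar> > t\<close> the
  series of the \<open>a n / z ^ (n + 1)\<close>, plus the contribution of the pole at 1, is a functional
  of \<open>f\<close> that inverts \<open>z - Q\<close>: composed with \<open>z - Q\<close> it is evaluation at \<open>x\<close>. Hence it has norm at most
  \<open>c * V x\<close>, and Cauchy's coefficient formula on \<open>\<bar>z\<bar> = s\<close> gives \<open>\<bar>a n\<bar> \<le> c * s ^ (n + 1) * V x\<close> for every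
  \<open>s > t\<close> between \<open>r\<close> and \<open>1 - \<theta>\<close>; the pole at 1 contributes nothing since the circle lies inside the
  unit disc. The same
  reasoning for the squared resolvent gives \<open>(n + 1) * \<bar>a n\<bar> \<le> c\<^sup>2 * s ^ (n + 2) * V x\<close>, and this extra
  factor \<open>n + 1\<close> shows that the rate \<open>t\<close> can be replaced by \<open>q * t\<close> with \<open>q < 1\<close> depending on \<open>c\<close> only.
  Finitely many such steps lead from the given rate of \<open>Q\<close> down to any number above \<open>r\<close>
  (\<open>uniform_rate\<close>), with the constant \<open>c\<close> at the end.

  For the invariant measures, \<open>\<pi>(Q ^ n f)\<close> is compared with \<open>\<pi>(f)\<close> by telescoping, at the cost
  \<open>n * \<Delta> * \<pi>(V)\<close>, and with the projection of \<open>f\<close> by the rate just obtained; then \<open>n\<close> is chosen so that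
  \<open>r ^ n\<close> is about \<open>\<Delta>\<close> (\<open>invariant_integral_perturbation\<close>, \<open>bound_at_optimal_time\<close>).
\<close>

section \<open>Coefficients of a power series plus a pole at 1\<close>

text \<open>
  On a circle around both poles, \<open>1 / (1 - w)\<close> is a series of strictly negative powers of \<open>w\<close>, so it
  has no Taylor-type coefficients there. Partial fractions reduce the claim to \<open>n = 0\<close>, where the
  residues at 0 and 1 cancel.
\<close>

lemma contour_integral_inverse_power_times_geometric:
  fixes R :: real
  assumes R: "1 < R"
  shows "((\<lambda>w. 1 / (w ^ Suc n * (1 - w))) has_contour_integral 0) (circlepath 0 R)"
    and "((\<lambda>w. 1 / (w ^ Suc n * (1 - w)\<^sup>2)) has_contour_integral 0) (circlepath 0 R)"
proof -
  note Cauchy = Cauchy_has_contour_integral_higher_derivative_circlepath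
    [where f = "\<lambda>_. 1::complex" and z = 0 and r = R]
  have on_circle: "w \<noteq> 0 \<and> w \<noteq> 1" if "w \<in> path_image (circlepath 0 R)" for w
    using that R by auto
  have pole_at_0: "((\<lambda>w. 1 / w ^ Suc k) has_contour_integral (if k = 0 then 2 * pi * \<i> else 0)) (circlepath 0 R)" for k
    using Cauchy[of 0 k] R by (cases k) auto
  have pole_at_1: "((\<lambda>w. 1 / (1 - w)) has_contour_integral - (2 * pi * \<i>)) (circlepath 0 R)"
  proof -
    have "((\<lambda>w. - (1 / (w - 1))) has_contour_integral - (2 * pi * \<i>)) (circlepath 0 R)"
      using Cauchy[of 1 0] R by (intro has_contour_integral_neg) auto
    then show ?thesis
      by (rule has_contour_integral_eq) (auto simp: divide_simps dest: on_circle)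
  qed
  have double_pole_at_1: "((\<lambda>w. 1 / (1 - w)\<^sup>2) has_contour_integral 0) (circlepath 0 R)"
  proof -
    have "((\<lambda>w. 1 / (w - 1)\<^sup>2) has_contour_integral 0) (circlepath 0 R)"
      using Cauchy[of 1 1] R by (auto simp: power2_eq_square)
    then show ?thesis
      by (rule has_contour_integral_eq) (auto simp: power2_commute)
  qed
  show simple: "((\<lambda>w. 1 / (w ^ Suc n * (1 - w))) has_contour_integral 0) (circlepath 0 R)" for n
  proof (induction n)
    case 0
    show ?case
      using has_contour_integral_add[OF pole_at_0[of 0] pole_at_1]
      by (auto elim!: has_contour_integral_eq simp: field_simps dest: on_circle)
  next
    case (Suc n)
    show ?case
      using has_contour_integral_add[OF pole_at_0[of "Suc n"] Suc]
      by (auto elim!: has_contour_integral_eq simp: field_simps dest: on_circle)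
  qed
  show "((\<lambda>w. 1 / (w ^ Suc n * (1 - w)\<^sup>2)) has_contour_integral 0) (circlepath 0 R)"
  proof (induction n)
    case 0
    show ?case
      using has_contour_integral_add[OF simple[of 0] double_pole_at_1]
      by (auto elim!: has_contour_integral_eq simp: divide_simps power2_eq_square dest: on_circle)
  next
    case (Suc n)
    show ?case
      using has_contour_integral_add[OF simple[of "Suc n"] Suc]
      by (auto elim!: has_contour_integral_eq simp: divide_simps power2_eq_square dest: on_circle)
  qed
qed

text \<open>
  Cauchy's estimate for a power series of which only the sum with a function \<open>g\<close> is controlled on the
  circle; \<open>g\<close> is harmless because it is orthogonal to \<open>w ^ n\<close>. It will be the pole of the resolvent
  at the eigenvalue 1.
\<close>

lemma power_series_coefficient_bound:
  fixes a :: "nat \<Rightarrow> complex" and g :: "complex \<Rightarrow> complex"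
  assumes R: "0 < R" "R < R'"
    and summ: "summable (\<lambda>l. norm (a l) * R' ^ l)"
    and g: "((\<lambda>w. g w / w ^ Suc n) has_contour_integral 0) (circlepath 0 R)"
    and bound: "\<And>w. norm w = R \<Longrightarrow> norm ((\<Sum>l. a l * w ^ l) + g w) \<le> K"
  shows "norm (a n) \<le> K / R ^ n"
proof -
  define F where "F = Abs_fps a"
  define h where "h = eval_fps F"
  have h: "h w = (\<Sum>l. a l * w ^ l)" for w
    by (simp add: h_def F_def eval_fps_def)
  have "fps_conv_radius F \<ge> ereal R'"
  proof -
    have "summable (\<lambda>l. a l * of_real R' ^ l)"
      using summ R by (intro summable_norm_cancel[where f = "\<lambda>l. a l * of_real R' ^ l"])
        (simp add: norm_mult norm_power)
    then have "conv_radius a \<ge> norm (of_real R' :: complex)"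
      by (rule conv_radius_geI)
    then show ?thesis
      using R by (simp add: fps_conv_radius_def F_def)
  qed
  then have radius: "fps_conv_radius F > ereal R"
    using R by (metis less_ereal.simps(1) order.strict_trans2)
  have sub: "cball 0 R \<subseteq> eball 0 (fps_conv_radius F)"
    using radius by (auto simp: eball_def intro: le_less_trans[of _ "ereal R"])
  have hol: "h holomorphic_on eball 0 (fps_conv_radius F)"
    unfolding h_def by (rule holomorphic_on_eval_fps) auto
  have "(deriv ^^ n) h 0 / fact n = a n"
  proof -
    have "h has_fps_expansion F"
      using radius R unfolding h_def has_fps_expansion_def
      by (metis ereal_less(2) eventually_True less_trans)
    from fps_nth_fps_expansion[OF this, of n] show ?thesis
      by (simp add: F_def)
  qed
  moreover have "((\<lambda>w. h w / (w - 0) ^ Suc n) has_contour_integral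
      (2 * pi * \<i>) / fact n * (deriv ^^ n) h 0) (circlepath 0 R)"
    using R
    by (intro Cauchy_has_contour_integral_higher_derivative_circlepath
        holomorphic_on_imp_continuous_on holomorphic_on_subset[OF hol]) (use sub in auto)
  ultimately have "((\<lambda>w. h w / w ^ Suc n) has_contour_integral (2 * pi * \<i>) * a n) (circlepath 0 R)"
    by (simp add: field_simps)
  from has_contour_integral_add[OF this g]
  have int: "((\<lambda>w. (h w + g w) / w ^ Suc n) has_contour_integral (2 * pi * \<i>) * a n) (circlepath 0 R)"
    by (simp add: add_divide_distrib)
  have K: "0 \<le> K"
    using bound[of "of_real R"] R norm_ge_zero by (metis abs_of_pos norm_of_real order_trans)
  have "norm ((2 * pi * \<i>) * a n) \<le> K / R ^ Suc n * (2 * pi * R)"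
    by (rule has_contour_integral_bound_circlepath[OF int])
      (use R K bound in \<open>auto simp: h norm_divide norm_power norm_mult divide_simps\<close>)
  then show ?thesis
    using R by (simp add: norm_mult field_simps)
qed

section \<open>Weighted supremum norms\<close>

text \<open>
  The closed ball of radius \<open>C\<close> of the weighted space, described without a supremum.
\<close>

definition wball :: "'a measure \<Rightarrow> ('a \<Rightarrow> real) \<Rightarrow> real \<Rightarrow> ('a \<Rightarrow> complex) set" where
  "wball M W C = {f \<in> borel_measurable M.
     (\<forall>x\<in>space M. cmod (f x) \<le> C * W x) \<and> (\<forall>x. x \<notin> space M \<longrightarrow> f x = 0)}"

lemma wballI:
  assumes "f \<in> borel_measurable M" "\<And>x. x \<in> space M \<Longrightarrow> cmod (f x) \<le> C * W x"
    "\<And>x. x \<notin> space M \<Longrightarrow> f x = 0"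
  shows "f \<in> wball M W C"
  using assms by (auto simp: wball_def)

lemma wballD:
  assumes "f \<in> wball M W C"
  shows "f \<in> borel_measurable M" "\<And>x. x \<in> space M \<Longrightarrow> cmod (f x) \<le> C * W x"
    "\<And>x. x \<notin> space M \<Longrightarrow> f x = 0"
  using assms by (auto simp: wball_def)

lemma wball_add: "f \<in> wball M W C \<Longrightarrow> g \<in> wball M W D \<Longrightarrow> (\<lambda>x. f x + g x) \<in> wball M W (C + D)"
  unfolding wball_def by (auto simp: distrib_right intro: norm_triangle_mono)

lemma wball_diff: "f \<in> wball M W C \<Longrightarrow> g \<in> wball M W D \<Longrightarrow> (\<lambda>x. f x - g x) \<in> wball M W (C + D)"
  unfolding wball_def by (auto simp: distrib_right intro!: order_trans[OF norm_triangle_ineq4] add_mono)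

lemma wball_scale: "f \<in> wball M W C \<Longrightarrow> (\<lambda>x. a * f x) \<in> wball M W (cmod a * C)"
  unfolding wball_def by (auto simp: norm_mult mult.assoc intro: mult_left_mono)

lemma wball_mono:
  assumes "f \<in> wball M W C" "C \<le> D" "\<And>x. x \<in> space M \<Longrightarrow> 0 \<le> W x"
  shows "f \<in> wball M W D"
  using assms unfolding wball_def by (auto intro: order_trans[OF _ mult_right_mono])

locale weighted_space =
  fixes M :: "'a measure" and V :: "'a \<Rightarrow> real"
  assumes V_meas [measurable]: "V \<in> borel_measurable M"
    and V_ge_1: "\<And>x. x \<in> space M \<Longrightarrow> 1 \<le> V x"
    and space_nonempty: "space M \<noteq> {}"
begin

text \<open>
  Only two weights occur: \<open>V\<close> for the strong and 1 for the weak norm.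
\<close>

definition weight :: "('a \<Rightarrow> real) \<Rightarrow> bool" where
  "weight W \<longleftrightarrow> W = V \<or> W = (\<lambda>_. 1)"

lemma weight_V [simp]: "weight V" and weight_1 [simp]: "weight (\<lambda>_. 1)"
  by (auto simp: weight_def)

lemma weight_bounds: "weight W \<Longrightarrow> x \<in> space M \<Longrightarrow> 1 \<le> W x \<and> W x \<le> V x"
  using V_ge_1 by (auto simp: weight_def)

lemma V_nonneg: "x \<in> space M \<Longrightarrow> 0 \<le> V x"
  using V_ge_1 by fastforce

lemma wball_nonneg:
  assumes "f \<in> wball M W C" "weight W" shows "0 \<le> C"
proof -
  obtain x where x: "x \<in> space M" using space_nonempty by blast
  have "0 \<le> C * W x" using wballD(2)[OF assms(1) x] norm_ge_zero order_trans by blast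
  then show ?thesis using weight_bounds[OF assms(2) x] by (simp add: zero_le_mult_iff)
qed

lemma wball_increase:
  assumes "f \<in> wball M W C" "C \<le> D" "weight W"
  shows "f \<in> wball M W D"
  by (rule wball_mono[OF assms(1,2)]) (use weight_bounds[OF assms(3)] in fastforce)

lemma wball_weight_V:
  assumes "f \<in> wball M W C" "weight W"
  shows "f \<in> wball M V C"
proof (rule wballI)
  fix x assume "x \<in> space M"
  then show "cmod (f x) \<le> C * V x"
    using wballD(2)[OF assms(1)] weight_bounds[OF assms(2)] wball_nonneg[OF assms]
    by (meson mult_left_mono order_trans)
qed (use wballD[OF assms(1)] in auto)

lemma wspace_iff_wball:
  assumes "weight W"
  shows "f \<in> wspace M W \<longleftrightarrow> (\<exists>C. f \<in> wball M W C)"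
proof -
  have "bdd_above ((\<lambda>x. cmod (f x) / W x) ` space M) \<longleftrightarrow> (\<exists>C. \<forall>x\<in>space M. cmod (f x) \<le> C * W x)"
    using weight_bounds[OF assms] unfolding bdd_above_def
    by (fastforce simp: divide_le_eq)
  then show ?thesis by (auto simp: wspace_def wball_def)
qed

lemma wnorm_le_iff:
  assumes "weight W" "f \<in> wspace M W"
  shows "wnorm M W f \<le> C \<longleftrightarrow> f \<in> wball M W C"
proof -
  have "wnorm M W f \<le> C \<longleftrightarrow> (\<forall>x\<in>space M. cmod (f x) / W x \<le> C)"
    unfolding wnorm_def using assms(2) space_nonempty
    by (subst cSUP_le_iff) (auto simp: wspace_def)
  also have "\<dots> \<longleftrightarrow> (\<forall>x\<in>space M. cmod (f x) \<le> C * W x)"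
    using weight_bounds[OF assms(1)] by (fastforce simp: divide_le_eq)
  finally show ?thesis using assms(2) by (auto simp: wspace_def wball_def)
qed

lemma unit_ball_eq:
  assumes "weight W"
  shows "{f \<in> wspace M W. wnorm M W f \<le> C} = wball M W C"
  using wnorm_le_iff[OF assms] wspace_iff_wball[OF assms] by blast

lemma wspace_wball_wnorm:
  assumes "weight W" "f \<in> wspace M W"
  shows "f \<in> wball M W (wnorm M W f)"
  using wnorm_le_iff[OF assms] by blast

lemma wball_1_in_wspace: "f \<in> wball M (\<lambda>_. 1) C \<Longrightarrow> f \<in> wspace M V"
  using wball_weight_V weight_1 wspace_iff_wball weight_V by blast

lemma wball_V_in_wspace: "f \<in> wball M V C \<Longrightarrow> f \<in> wspace M V"
  using wspace_iff_wball weight_V by blast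

lemma wspace_V_cases:
  assumes "f \<in> wspace M V"
  obtains C where "0 \<le> C" "f \<in> wball M V C"
  using assms wspace_iff_wball[OF weight_V] wball_nonneg[OF _ weight_V] by blast

lemma zero_in_wball: "0 \<le> C \<Longrightarrow> weight W \<Longrightarrow> (\<lambda>_. 0) \<in> wball M W C"
  using weight_bounds by (fastforce intro!: wballI mult_nonneg_nonneg)

lemma wspace_add: "f \<in> wspace M V \<Longrightarrow> g \<in> wspace M V \<Longrightarrow> (\<lambda>x. f x + g x) \<in> wspace M V"
  by (elim wspace_V_cases) (rule wball_V_in_wspace[OF wball_add])

lemma wspace_diff: "f \<in> wspace M V \<Longrightarrow> g \<in> wspace M V \<Longrightarrow> (\<lambda>x. f x - g x) \<in> wspace M V"
  by (elim wspace_V_cases) (rule wball_V_in_wspace[OF wball_diff])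

lemma wspace_scale: "f \<in> wspace M V \<Longrightarrow> (\<lambda>x. a * f x) \<in> wspace M V"
  by (elim wspace_V_cases) (rule wball_V_in_wspace[OF wball_scale])

lemma opnorm_eq:
  assumes "weight U"
  shows "opnorm M U W T = (SUP f\<in>wball M U 1. wnorm M W (T f))"
proof -
  have "{wnorm M W (T f) | f. f \<in> wspace M U \<and> wnorm M U f \<le> 1} = (\<lambda>f. wnorm M W (T f)) ` wball M U 1"
    using unit_ball_eq[OF assms, of 1] by (auto simp: image_iff)
  then show ?thesis by (simp add: opnorm_def)
qed

lemma opnorm_le:
  assumes "weight U" "weight W" "\<And>f. f \<in> wball M U 1 \<Longrightarrow> T f \<in> wball M W C"
  shows "opnorm M U W T \<le> C"
  unfolding opnorm_eq[OF assms(1)]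
proof (rule cSUP_least)
  show "wball M U 1 \<noteq> {}" using zero_in_wball[OF zero_le_one assms(1)] by blast
  fix f assume "f \<in> wball M U 1"
  with assms(3) have "T f \<in> wball M W C" by blast
  then show "wnorm M W (T f) \<le> C"
    using wnorm_le_iff[OF assms(2)] wspace_iff_wball[OF assms(2)] by blast
qed

text \<open>
  A real supremum bounds its members only if the set is bounded above, whence the hypothesis that some
  \<open>C\<close> works on the unit ball.
\<close>

lemma opnorm_wball:
  assumes "weight U" "weight W" "\<And>f. f \<in> wball M U 1 \<Longrightarrow> T f \<in> wball M W C"
    and hom: "\<And>a f. f \<in> wspace M U \<Longrightarrow> T (\<lambda>x. a * f x) = (\<lambda>x. a * T f x)"
    and f: "f \<in> wball M U D"
  shows "T f \<in> wball M W (opnorm M U W T * D)"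
proof -
  have unit: "T g \<in> wball M W (opnorm M U W T)" if g: "g \<in> wball M U 1" for g
  proof -
    have in_W: "T h \<in> wspace M W" if "h \<in> wball M U 1" for h
      using that assms(3) wspace_iff_wball[OF assms(2)] by blast
    have "wnorm M W (T g) \<le> opnorm M U W T"
      unfolding opnorm_eq[OF assms(1)]
      by (rule cSUP_upper2[OF bdd_aboveI2[where M = C] g order_refl])
        (use assms(3) in_W wnorm_le_iff[OF assms(2)] in blast)
    then show ?thesis using wnorm_le_iff[OF assms(2)] in_W[OF g] by blast
  qed
  have scale: "T f \<in> wball M W (opnorm M U W T * E)" if "f \<in> wball M U E" "0 < E" for E
  proof -
    define g where "g = (\<lambda>x. complex_of_real (inverse E) * f x)"
    have "g \<in> wball M U 1"
      using wball_scale[OF that(1), of "complex_of_real (inverse E)"] that(2)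
      by (simp add: g_def norm_mult norm_inverse)
    note g = this
    have f_eq: "f = (\<lambda>x. complex_of_real E * g x)" using that(2) by (auto simp: g_def)
    have "T f = (\<lambda>x. complex_of_real E * T g x)"
      by (subst f_eq, rule hom) (use g wspace_iff_wball[OF assms(1)] in blast)
    with wball_scale[OF unit[OF g], of "complex_of_real E"] that(2)
    show ?thesis by (simp add: mult.commute)
  qed
  show ?thesis
  proof (cases "D = 0")
    case True
    have "f x = 0" for x
      using wballD[OF f] True by (cases "x \<in> space M") auto
    then have "f = (\<lambda>x. 0 * f x)" by auto
    then have "T f = (\<lambda>x. 0 * T f x)" using hom[of f 0] f wspace_iff_wball[OF assms(1)] by metis
    then have "T f = (\<lambda>x. 0)" by simp
    then show ?thesis using True zero_in_wball[OF order_refl assms(2)] by simp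
  next
    case False
    with wball_nonneg[OF f assms(1)] scale[OF f] show ?thesis by simp
  qed
qed

lemma indicator_in_wball: "(\<lambda>x. if x \<in> space M then 1 else 0) \<in> wball M (\<lambda>_. 1) 1"
  by (auto intro!: wballI)

end

section \<open>Bounded functionals on the weighted space\<close>

locale bounded_functional = weighted_space +
  fixes m :: "('a \<Rightarrow> complex) \<Rightarrow> complex"
  assumes m_add: "\<And>f g. f \<in> wspace M V \<Longrightarrow> g \<in> wspace M V \<Longrightarrow> m (\<lambda>x. f x + g x) = m f + m g"
    and m_scale: "\<And>a f. f \<in> wspace M V \<Longrightarrow> m (\<lambda>x. a * f x) = a * m f"
    and m_bounded: "\<exists>C. \<forall>f\<in>wball M V 1. cmod (m f) \<le> C"
begin

definition fnorm :: "('a \<Rightarrow> real) \<Rightarrow> real" where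
  "fnorm W = (SUP f\<in>wball M W 1. cmod (m f))"

lemma m_diff:
  assumes "f \<in> wspace M V" "g \<in> wspace M V"
  shows "m (\<lambda>x. f x - g x) = m f - m g"
  using m_add[OF assms(1) wspace_scale[OF assms(2), of "-1"]] m_scale[OF assms(2), of "-1"] by simp

lemma fnorm_unit:
  assumes "weight W" "f \<in> wball M W 1"
  shows "cmod (m f) \<le> fnorm W"
proof -
  obtain C where "\<forall>f\<in>wball M V 1. cmod (m f) \<le> C" using m_bounded by blast
  then have "bdd_above ((\<lambda>f. cmod (m f)) ` wball M W 1)"
    using wball_weight_V[OF _ assms(1)] by (intro bdd_aboveI2) blast
  then show ?thesis unfolding fnorm_def using assms(2) by (intro cSUP_upper)
qed

lemma fnorm_nonneg: assumes "weight W" shows "0 \<le> fnorm W"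
  using fnorm_unit[OF assms zero_in_wball[OF zero_le_one assms]] norm_ge_zero order_trans by blast

lemma fnorm_bound:
  assumes "weight W" and f: "f \<in> wball M W C"
  shows "cmod (m f) \<le> fnorm W * C"
proof (cases "C = 0")
  case True
  have "f x = 0" for x
    using wballD[OF f] True by (cases "x \<in> space M") auto
  then have "f = (\<lambda>x. 0 * f x)" by auto
  moreover have "f \<in> wspace M V" using wball_weight_V[OF f assms(1)] wball_V_in_wspace by blast
  ultimately have "m f = 0 * m f" using m_scale[of f 0] by metis
  then show ?thesis using True by simp
next
  case False
  then have C: "0 < C" using wball_nonneg[OF f assms(1)] by simp
  have f_in: "f \<in> wspace M V" using wball_weight_V[OF f assms(1)] wball_V_in_wspace by blast
  have "(\<lambda>x. complex_of_real (inverse C) * f x) \<in> wball M W 1"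
    using wball_scale[OF f, of "complex_of_real (inverse C)"] C by (simp add: norm_inverse)
  from fnorm_unit[OF assms(1) this] have "cmod (m f) / C \<le> fnorm W"
    using C by (simp only: m_scale[OF f_in]) (simp add: norm_mult norm_inverse divide_inverse mult.commute)
  then show ?thesis using C by (simp add: divide_le_eq)
qed

lemma fnorm_le:
  assumes "weight W" "\<And>f. f \<in> wball M W 1 \<Longrightarrow> cmod (m f) \<le> C"
  shows "fnorm W \<le> C"
  unfolding fnorm_def using zero_in_wball[OF zero_le_one assms(1)] assms(2)
  by (intro cSUP_least) blast+

end

section \<open>Kernels with a drift condition\<close>

locale drift_kernel = weighted_space M V for M :: "'a measure" and V +
  fixes K :: "'a \<Rightarrow> 'a measure" and \<delta> L :: real
  assumes K_meas [measurable]: "K \<in> M \<rightarrow>\<^sub>M subprob_algebra M"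
    and drift: "\<And>x. x \<in> space M \<Longrightarrow> (\<integral>\<^sup>+ y. ennreal (V y) \<partial>K x) \<le> ennreal (\<delta> * V x + L)"
    and delta: "0 < \<delta>" "\<delta> < 1" and L_pos: "0 < L"
begin

abbreviation T :: "('a \<Rightarrow> complex) \<Rightarrow> 'a \<Rightarrow> complex" where
  "T \<equiv> kernel_op M K"

lemma sets_K: "x \<in> space M \<Longrightarrow> sets (K x) = sets M"
  using sets_kernel[OF K_meas] .

lemma space_K: "x \<in> space M \<Longrightarrow> space (K x) = space M"
  using sets_K sets_eq_imp_space_eq by blast

lemma measurable_K: "x \<in> space M \<Longrightarrow> f \<in> borel_measurable M \<Longrightarrow> f \<in> borel_measurable (K x)"
  using measurable_cong_sets[OF sets_K refl] by blast

lemma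
  assumes x: "x \<in> space M"
  shows integrable_V: "integrable (K x) V"
    and integral_V_le: "(LINT y|K x. V y) \<le> \<delta> * V x + L"
proof -
  have nonneg: "AE y in K x. 0 \<le> V y"
    using V_nonneg space_K[OF x] by (intro AE_I2) auto
  have fin: "(\<integral>\<^sup>+ y. ennreal (V y) \<partial>K x) < \<infinity>"
    using drift[OF x] by (auto intro: le_less_trans)
  show "integrable (K x) V"
    by (rule integrableI_nonneg[OF measurable_K[OF x V_meas] nonneg fin])
  then show "(LINT y|K x. V y) \<le> \<delta> * V x + L"
    using drift[OF x] nn_integral_eq_integral[OF _ nonneg] V_nonneg[OF x] delta L_pos
    by (metis ennreal_le_iff add_nonneg_nonneg less_imp_le mult_nonneg_nonneg)
qed

lemma integrable_K:
  fixes f :: "'a \<Rightarrow> complex"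
  assumes x: "x \<in> space M" and f: "f \<in> wspace M V"
  shows "integrable (K x) f"
proof -
  obtain C where C: "0 \<le> C" "f \<in> wball M V C" using wspace_V_cases[OF f] by blast
  show ?thesis
  proof (rule Bochner_Integration.integrable_bound)
    show "integrable (K x) (\<lambda>y. C * V y)" using integrable_V[OF x] by simp
    show "f \<in> borel_measurable (K x)" using measurable_K[OF x] wballD(1)[OF C(2)] .
    show "AE y in K x. cmod (f y) \<le> norm (C * V y)"
      using wballD(2)[OF C(2)] space_K[OF x] by (intro AE_I2) (force intro: order_trans[OF _ abs_ge_self])
  qed
qed

lemma T_measurable: "f \<in> borel_measurable M \<Longrightarrow> T f \<in> borel_measurable M"
  unfolding kernel_op_def
  by (intro measurable_If measurable_compose[OF K_meas integral_measurable_subprob_algebra]) auto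

text \<open>
  One step of the kernel on an affine majorant \<open>a * V + b\<close>. The total mass at most 1 is what
  keeps the constant \<open>b\<close>.
\<close>

lemma T_affine_bound:
  assumes f: "f \<in> wspace M V" and ab: "0 \<le> a" "0 \<le> b"
    and bound: "\<And>y. y \<in> space M \<Longrightarrow> cmod (f y) \<le> a * V y + b"
    and x: "x \<in> space M"
  shows "cmod (T f x) \<le> a * (\<delta> * V x + L) + b"
proof -
  interpret K: subprob_space "K x" using subprob_space_kernel[OF K_meas x] .
  have "cmod (T f x) \<le> (LINT y|K x. cmod (f y))"
    using x by (simp add: kernel_op_def integral_norm_bound)
  also have "\<dots> \<le> (LINT y|K x. a * V y + b)"
    using integrable_K[OF x f] integrable_V[OF x] bound space_K[OF x]
    by (intro integral_mono) auto
  also have "\<dots> = a * (LINT y|K x. V y) + b * measure (K x) (space (K x))"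
    using integrable_V[OF x] by simp
  also have "\<dots> \<le> a * (\<delta> * V x + L) + b * 1"
    using ab integral_V_le[OF x] K.subprob_measure_le_1[of "space (K x)"]
    by (intro add_mono mult_left_mono) auto
  finally show ?thesis by simp
qed

lemma T_wball_V: assumes f: "f \<in> wball M V C" shows "T f \<in> wball M V (C * (\<delta> + L))"
proof (rule wballI)
  show "T f \<in> borel_measurable M" using T_measurable wballD(1)[OF f] .
  have C: "0 \<le> C" using wball_nonneg[OF f] by simp
  fix x assume x: "x \<in> space M"
  have "cmod (T f x) \<le> C * (\<delta> * V x + L) + 0"
    using wballD(2)[OF f] C x by (intro T_affine_bound wball_V_in_wspace[OF f]) auto
  also have "\<dots> \<le> C * ((\<delta> + L) * V x)"
    using C L_pos V_ge_1[OF x] by (auto intro!: mult_left_mono simp: algebra_simps)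
  finally show "cmod (T f x) \<le> C * (\<delta> + L) * V x" by (simp add: mult.assoc)
qed (simp add: kernel_op_def)

lemma T_wspace: "f \<in> wspace M V \<Longrightarrow> T f \<in> wspace M V"
  using T_wball_V wspace_iff_wball[OF weight_V] by blast

lemma T_wball_1: assumes f: "f \<in> wball M (\<lambda>_. 1) C" shows "T f \<in> wball M (\<lambda>_. 1) C"
proof (rule wballI)
  show "T f \<in> borel_measurable M" using T_measurable wballD(1)[OF f] .
  show "cmod (T f x) \<le> C * 1" if "x \<in> space M" for x
    using T_affine_bound[OF wball_1_in_wspace[OF f], of 0 C x] wballD(2)[OF f] that
      wball_nonneg[OF f] by simp
qed (simp add: kernel_op_def)

lemma T_add: "f \<in> wspace M V \<Longrightarrow> g \<in> wspace M V \<Longrightarrow> T (\<lambda>x. f x + g x) = (\<lambda>x. T f x + T g x)"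
  using integrable_K by (auto simp: kernel_op_def)

lemma T_scale: "T (\<lambda>x. a * f x) = (\<lambda>x. a * T f x)"
  by (auto simp: kernel_op_def)

lemma T_diff: "f \<in> wspace M V \<Longrightarrow> g \<in> wspace M V \<Longrightarrow> T (\<lambda>x. f x - g x) = (\<lambda>x. T f x - T g x)"
  using integrable_K by (auto simp: kernel_op_def)

lemma iter_wspace: "f \<in> wspace M V \<Longrightarrow> (T ^^ n) f \<in> wspace M V"
  by (induction n) (auto intro: T_wspace)

lemma iter_wball_1: "f \<in> wball M (\<lambda>_. 1) C \<Longrightarrow> (T ^^ n) f \<in> wball M (\<lambda>_. 1) C"
  by (induction n) (auto intro: T_wball_1)

lemma iter_add: "f \<in> wspace M V \<Longrightarrow> g \<in> wspace M V \<Longrightarrow>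
    (T ^^ n) (\<lambda>x. f x + g x) = (\<lambda>x. (T ^^ n) f x + (T ^^ n) g x)"
  by (induction n) (auto simp: T_add iter_wspace)

lemma iter_diff: "f \<in> wspace M V \<Longrightarrow> g \<in> wspace M V \<Longrightarrow>
    (T ^^ n) (\<lambda>x. f x - g x) = (\<lambda>x. (T ^^ n) f x - (T ^^ n) g x)"
  by (induction n) (auto simp: T_diff iter_wspace)

lemma iter_scale: "(T ^^ n) (\<lambda>x. a * f x) = (\<lambda>x. a * (T ^^ n) f x)"
  by (induction n) (auto simp: T_scale)

lemma iter_affine_bound:
  assumes f: "f \<in> wball M V C" and x: "x \<in> space M"
  shows "cmod ((T ^^ n) f x) \<le> C * (\<delta> ^ n * V x + L / (1 - \<delta>))"
proof -
  have C: "0 \<le> C" using wball_nonneg[OF f] by simp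
  \<comment> \<open>The constant \<open>L / (1 - \<delta>)\<close> is the limit of the partial geometric sums produced by the drift.\<close>
  have "cmod ((T ^^ n) f x) \<le> C * \<delta> ^ n * V x + C * (L * (1 - \<delta> ^ n) / (1 - \<delta>))"
    using x
  proof (induction n arbitrary: x)
    case 0
    then show ?case using wballD(2)[OF f] by simp
  next
    case (Suc n)
    have d: "\<delta> ^ n \<le> 1" using delta by (simp add: power_le_one)
    have "cmod ((T ^^ Suc n) f x)
        \<le> C * \<delta> ^ n * (\<delta> * V x + L) + C * (L * (1 - \<delta> ^ n) / (1 - \<delta>))"
      using Suc C d delta L_pos
      by (simp, intro T_affine_bound iter_wspace wball_V_in_wspace[OF f]) auto
    also have "\<dots> = C * \<delta> ^ Suc n * V x + C * (L * (1 - \<delta> ^ Suc n) / (1 - \<delta>))"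
      using delta by (simp add: field_simps)
    finally show ?case .
  qed
  also have "\<dots> \<le> C * \<delta> ^ n * V x + C * (L / (1 - \<delta>))"
    using C delta L_pos by (intro add_left_mono mult_left_mono divide_right_mono) auto
  finally show ?thesis by (simp add: algebra_simps)
qed

lemma iter_wball_V:
  assumes f: "f \<in> wball M V C"
  shows "(T ^^ n) f \<in> wball M V (C * (1 + L / (1 - \<delta>)))"
proof (rule wballI)
  have in_V: "(T ^^ n) f \<in> wspace M V" using iter_wspace wball_V_in_wspace[OF f] by blast
  then show "(T ^^ n) f \<in> borel_measurable M" and "\<And>x. x \<notin> space M \<Longrightarrow> (T ^^ n) f x = 0"
    by (auto simp: wspace_def)
  fix x assume x: "x \<in> space M"
  have "\<delta> ^ n * V x + L / (1 - \<delta>) \<le> 1 * V x + L / (1 - \<delta>) * V x"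
    using delta L_pos V_ge_1[OF x]
    by (intro add_mono mult_right_mono power_le_one) (auto simp: divide_simps)
  then have "C * (\<delta> ^ n * V x + L / (1 - \<delta>)) \<le> C * (1 * V x + L / (1 - \<delta>) * V x)"
    using wball_nonneg[OF f] by (intro mult_left_mono) auto
  with iter_affine_bound[OF f x, of n]
  show "cmod ((T ^^ n) f x) \<le> C * (1 + L / (1 - \<delta>)) * V x" by (simp add: algebra_simps)
qed

text \<open>
  The Doeblin-Fortet inequality in primal form. Since \<open>T ^ n f\<close> is dominated by
  \<open>C * (\<delta> ^ n * V + L / (1 - \<delta>))\<close>, it can be divided pointwise in proportion to the two summands of
  this majorant.
\<close>

lemma iter_split:
  assumes f: "f \<in> wball M V C"
  obtains g h where "g \<in> wball M V (C * \<delta> ^ n)" "h \<in> wball M (\<lambda>_. 1) (C * (L / (1 - \<delta>)))"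
    "(T ^^ n) f = (\<lambda>x. g x + h x)"
proof -
  define b where "b = L / (1 - \<delta>)"
  have b: "0 < b" using delta L_pos by (simp add: b_def)
  define s where "s = (\<lambda>x. \<delta> ^ n * V x + b)"
  have s_pos: "0 < s x" if "x \<in> space M" for x
    using V_nonneg[OF that] delta b by (auto simp: s_def intro!: add_nonneg_pos)
  have [measurable]: "s \<in> borel_measurable M" by (simp add: s_def)
  have in_V: "(T ^^ n) f \<in> wspace M V" using iter_wspace wball_V_in_wspace[OF f] by blast
  then have [measurable]: "(T ^^ n) f \<in> borel_measurable M" by (simp add: wspace_def)
  have zero: "(T ^^ n) f x = 0" if "x \<notin> space M" for x using in_V that by (simp add: wspace_def)
  have bound: "cmod ((T ^^ n) f x) \<le> C * s x" if "x \<in> space M" for x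
    using iter_affine_bound[OF f that] by (simp add: s_def b_def)
  define g where "g = (\<lambda>x. (T ^^ n) f x * complex_of_real (\<delta> ^ n * V x / s x))"
  define h where "h = (\<lambda>x. (T ^^ n) f x * complex_of_real (b / s x))"
  have part: "cmod ((T ^^ n) f x * complex_of_real (u / s x)) \<le> C * u" if "x \<in> space M" "0 \<le> u" for x u
  proof -
    have "cmod ((T ^^ n) f x * complex_of_real (u / s x)) = cmod ((T ^^ n) f x) * (u / s x)"
      using s_pos[OF that(1)] that(2) by (simp only: norm_mult norm_of_real) simp
    also have "\<dots> \<le> C * s x * (u / s x)"
      using bound[OF that(1)] s_pos[OF that(1)] that(2) by (intro mult_right_mono) auto
    also have "\<dots> = C * u" using s_pos[OF that(1)] by simp
    finally show ?thesis .
  qed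
  show ?thesis
  proof
    show "g \<in> wball M V (C * \<delta> ^ n)"
    proof (rule wballI)
      show "g \<in> borel_measurable M" unfolding g_def by measurable
      show "cmod (g x) \<le> C * \<delta> ^ n * V x" if "x \<in> space M" for x
        using part[OF that, of "\<delta> ^ n * V x"] V_nonneg[OF that] delta by (simp add: g_def mult.assoc)
    qed (simp add: g_def zero)
    show "h \<in> wball M (\<lambda>_. 1) (C * (L / (1 - \<delta>)))"
    proof (rule wballI)
      show "h \<in> borel_measurable M" unfolding h_def by measurable
      show "cmod (h x) \<le> C * (L / (1 - \<delta>)) * 1" if "x \<in> space M" for x
        using part[OF that, of b] b by (simp add: h_def b_def)
    qed (simp add: h_def zero)
    show "(T ^^ n) f = (\<lambda>x. g x + h x)"
    proof
      fix x
      show "(T ^^ n) f x = g x + h x"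
      proof (cases "x \<in> space M")
        case True
        then have "\<delta> ^ n * V x / s x + b / s x = 1"
          using s_pos[OF True] by (simp add: add_divide_distrib[symmetric]) (simp add: s_def)
        then have "complex_of_real (\<delta> ^ n * V x / s x) + complex_of_real (b / s x) = 1"
          by (metis of_real_1 of_real_add)
        then show ?thesis unfolding g_def h_def
          by (simp only: distrib_left[symmetric] mult_1_right)
      qed (simp add: g_def h_def zero)
    qed
  qed
qed

text \<open>
  The inequality for functionals follows by applying \<open>m\<close> to the two parts of the decomposition, the first
  being measured in the strong and the second in the weak norm.
\<close>

lemma Doeblin_Fortet:
  assumes "bounded_functional M V m" and f: "f \<in> wball M V C"
  shows "cmod (m ((T ^^ n) f)) \<le> C * (\<delta> ^ n * bounded_functional.fnorm M m V
      + L / (1 - \<delta>) * bounded_functional.fnorm M m (\<lambda>_. 1))"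
proof -
  interpret m: bounded_functional M V m by fact
  obtain g h where g: "g \<in> wball M V (C * \<delta> ^ n)" and h: "h \<in> wball M (\<lambda>_. 1) (C * (L / (1 - \<delta>)))"
    and eq: "(T ^^ n) f = (\<lambda>x. g x + h x)"
    using iter_split[OF f] .
  have "m ((T ^^ n) f) = m g + m h"
    unfolding eq using g h wball_V_in_wspace wball_1_in_wspace by (intro m.m_add) blast+
  then have "cmod (m ((T ^^ n) f)) \<le> cmod (m g) + cmod (m h)" by (simp add: norm_triangle_ineq)
  also have "\<dots> \<le> m.fnorm V * (C * \<delta> ^ n) + m.fnorm (\<lambda>_. 1) * (C * (L / (1 - \<delta>)))"
    by (intro add_mono m.fnorm_bound g h) auto
  finally show ?thesis by (simp add: algebra_simps)
qed

end

section \<open>Invariant measures and the rank-one projection\<close>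

locale invariant_kernel = drift_kernel M V K \<delta> L for M :: "'a measure" and V K \<delta> L +
  fixes \<mu> :: "'a measure"
  assumes mu_finite: "finite_measure \<mu>"
    and mu_invariant: "invariant_measure M K \<mu>"
    and mu_V: "(\<integral>\<^sup>+ x. ennreal (V x) \<partial>\<mu>) < \<infinity>"
begin

lemma sets_mu: "sets \<mu> = sets M"
  using mu_invariant by (simp add: invariant_measure_def)

lemma space_mu: "space \<mu> = space M"
  using sets_mu sets_eq_imp_space_eq by blast

lemma measurable_mu: "f \<in> borel_measurable M \<Longrightarrow> f \<in> borel_measurable \<mu>"
  using measurable_cong_sets[OF sets_mu refl] by blast

lemma K_meas_mu [measurable]: "K \<in> \<mu> \<rightarrow>\<^sub>M subprob_algebra M"
  using K_meas measurable_cong_sets[OF sets_mu refl] by blast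

text \<open>
  Invariance is given on sets; as an identity of measures it extends to all nonnegative integrands.
\<close>

lemma mu_bind: "\<mu> \<bind> K = \<mu>"
proof (rule measure_eqI)
  have nonempty: "space \<mu> \<noteq> {}" using space_mu space_nonempty by simp
  show "sets (\<mu> \<bind> K) = sets \<mu>"
    using sets_bind[of \<mu> K M] sets_K space_mu nonempty sets_mu by auto
  then show "emeasure (\<mu> \<bind> K) A = emeasure \<mu> A" if "A \<in> sets (\<mu> \<bind> K)" for A
    using that sets_mu mu_invariant emeasure_bind[OF nonempty K_meas_mu]
    by (simp add: invariant_measure_def)
qed

lemma nn_integral_mu: "u \<in> borel_measurable M \<Longrightarrow> (\<integral>\<^sup>+ x. u x \<partial>\<mu>) = (\<integral>\<^sup>+ x. \<integral>\<^sup>+ y. u y \<partial>K x \<partial>\<mu>)"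
  using nn_integral_bind[OF _ K_meas_mu] mu_bind by metis

lemma V_nonneg_AE_mu: "AE x in \<mu>. 0 \<le> V x"
  using V_nonneg space_mu by (intro AE_I2) auto

lemma integrable_V_mu: "integrable \<mu> V"
  by (rule integrableI_nonneg[OF measurable_mu[OF V_meas] V_nonneg_AE_mu mu_V])

text \<open>
  Integrate the drift inequality against \<open>\<mu>\<close>: \<open>\<mu>(V) \<le> \<delta> * \<mu>(V) + L * \<mu>(1)\<close>. Since \<open>\<mu>(V)\<close> is finite
  it can be absorbed.
\<close>

lemma integral_V_mu_le: "(LINT x|\<mu>. V x) \<le> L / (1 - \<delta>) * measure \<mu> (space M)"
proof -
  interpret mu: finite_measure \<mu> by (rule mu_finite)
  define v where "v = (LINT x|\<mu>. V x)"
  have v: "0 \<le> v" unfolding v_def using V_nonneg_AE_mu by (rule integral_nonneg_AE)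
  have int: "integrable \<mu> (\<lambda>x. \<delta> * V x + L)" using integrable_V_mu by simp
  have "ennreal v = (\<integral>\<^sup>+ x. ennreal (V x) \<partial>\<mu>)"
    unfolding v_def using nn_integral_eq_integral[OF integrable_V_mu V_nonneg_AE_mu] by simp
  also have "\<dots> = (\<integral>\<^sup>+ x. \<integral>\<^sup>+ y. ennreal (V y) \<partial>K x \<partial>\<mu>)"
    by (intro nn_integral_mu) simp
  also have "\<dots> \<le> (\<integral>\<^sup>+ x. ennreal (\<delta> * V x + L) \<partial>\<mu>)"
    using drift space_mu by (intro nn_integral_mono) auto
  also have "\<dots> = ennreal (LINT x|\<mu>. \<delta> * V x + L)"
    using V_nonneg space_mu delta L_pos by (intro nn_integral_eq_integral int AE_I2) auto
  also have "(LINT x|\<mu>. \<delta> * V x + L) = \<delta> * v + L * measure \<mu> (space M)"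
    unfolding v_def using integrable_V_mu by (simp add: space_mu)
  finally have "v \<le> \<delta> * v + L * measure \<mu> (space M)"
    using v delta L_pos by (subst (asm) ennreal_le_iff) auto
  then show ?thesis using delta by (fold v_def) (simp add: field_simps)
qed

lemma integrable_mu:
  fixes f :: "'a \<Rightarrow> complex"
  assumes f: "f \<in> wspace M V"
  shows "integrable \<mu> f"
proof -
  obtain C where C: "0 \<le> C" "f \<in> wball M V C" using wspace_V_cases[OF f] by blast
  show ?thesis
  proof (rule Bochner_Integration.integrable_bound)
    show "integrable \<mu> (\<lambda>y. C * V y)" using integrable_V_mu by simp
    show "f \<in> borel_measurable \<mu>" using measurable_mu wballD(1)[OF C(2)] .
    show "AE y in \<mu>. cmod (f y) \<le> norm (C * V y)"
      using wballD(2)[OF C(2)] space_mu by (intro AE_I2) (force intro: order_trans[OF _ abs_ge_self])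
  qed
qed

lemma integral_mu_bound_V:
  assumes f: "f \<in> wball M V C"
  shows "cmod (LINT x|\<mu>. f x) \<le> C * (LINT x|\<mu>. V x)"
proof -
  have "cmod (LINT x|\<mu>. f x) \<le> (LINT x|\<mu>. cmod (f x))" by (rule integral_norm_bound)
  also have "\<dots> \<le> (LINT x|\<mu>. C * V x)"
    using integrable_mu[OF wball_V_in_wspace[OF f]] integrable_V_mu wballD(2)[OF f] space_mu
    by (intro integral_mono) auto
  finally show ?thesis by simp
qed

lemma integral_mu_bound_1:
  assumes f: "f \<in> wball M (\<lambda>_. 1) C"
  shows "cmod (LINT x|\<mu>. f x) \<le> C * measure \<mu> (space M)"
proof -
  interpret mu: finite_measure \<mu> by (rule mu_finite)
  have "cmod (LINT x|\<mu>. f x) \<le> (LINT x|\<mu>. cmod (f x))" by (rule integral_norm_bound)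
  also have "\<dots> \<le> (LINT x|\<mu>. C)"
    using integrable_mu[OF wball_1_in_wspace[OF f]] wballD(2)[OF f] space_mu
    by (intro integral_mono) auto
  finally show ?thesis by (simp add: space_mu mult.commute)
qed

text \<open>
  The nonnegative case is Tonelli's theorem for \<open>\<mu> \<bind> K\<close>; the general case is obtained by adding the
  integrable function \<open>C * V\<close>.
\<close>

lemma integral_mu_real:
  fixes u :: "'a \<Rightarrow> real"
  assumes u [measurable]: "u \<in> borel_measurable M"
    and bound: "\<And>x. x \<in> space M \<Longrightarrow> \<bar>u x\<bar> \<le> C * V x"
  shows "(LINT x|\<mu>. LINT y|K x. u y) = (LINT x|\<mu>. u x)"
proof -
  have nonneg_case: "(LINT x|\<mu>. LINT y|K x. w y) = (LINT x|\<mu>. w x) \<and> integrable \<mu> (\<lambda>x. LINT y|K x. w y)"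
    if w [measurable]: "w \<in> borel_measurable M"
      and wV: "\<And>x. x \<in> space M \<Longrightarrow> 0 \<le> w x \<and> w x \<le> D * V x" for w :: "'a \<Rightarrow> real" and D
  proof -
    have bnd: "\<bar>w x\<bar> \<le> \<bar>D * V x\<bar>" if "x \<in> space M" for x using wV[OF that] by linarith
    have int_K: "integrable (K x) w" if x: "x \<in> space M" for x
      by (rule Bochner_Integration.integrable_bound[of _ "\<lambda>y. D * V y"])
        (use integrable_V[OF x] measurable_K[OF x w] bnd space_K[OF x] in \<open>auto intro!: AE_I2\<close>)
    have int_mu: "integrable \<mu> w"
      by (rule Bochner_Integration.integrable_bound[of _ "\<lambda>y. D * V y"])
        (use integrable_V_mu measurable_mu[OF w] bnd space_mu in \<open>auto intro!: AE_I2\<close>)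
    have Kw [measurable]: "(\<lambda>x. LINT y|K x. w y) \<in> borel_measurable \<mu>"
      using measurable_compose[OF K_meas_mu integral_measurable_subprob_algebra[OF w]] by simp
    have Kw_nonneg: "0 \<le> (LINT y|K x. w y)" if "x \<in> space M" for x
      using wV space_K[OF that] by (intro integral_nonneg_AE AE_I2) auto
    have "(\<integral>\<^sup>+ x. ennreal (LINT y|K x. w y) \<partial>\<mu>) = (\<integral>\<^sup>+ x. \<integral>\<^sup>+ y. ennreal (w y) \<partial>K x \<partial>\<mu>)"
    proof (rule nn_integral_cong)
      fix x assume "x \<in> space \<mu>"
      then have x: "x \<in> space M" using space_mu by simp
      show "ennreal (LINT y|K x. w y) = (\<integral>\<^sup>+ y. ennreal (w y) \<partial>K x)"
        using wV space_K[OF x] by (intro nn_integral_eq_integral[symmetric] int_K x AE_I2) auto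
    qed
    also have "\<dots> = (\<integral>\<^sup>+ x. ennreal (w x) \<partial>\<mu>)"
      by (intro nn_integral_mu[symmetric]) simp
    also have "\<dots> = ennreal (LINT x|\<mu>. w x)"
      using wV space_mu by (intro nn_integral_eq_integral int_mu AE_I2) auto
    finally have eq: "(\<integral>\<^sup>+ x. ennreal (LINT y|K x. w y) \<partial>\<mu>) = ennreal (LINT x|\<mu>. w x)" .
    have w_int_nonneg: "0 \<le> (LINT x|\<mu>. w x)"
      using wV space_mu by (intro integral_nonneg_AE AE_I2) auto
    have AE: "AE x in \<mu>. 0 \<le> (LINT y|K x. w y)"
      using Kw_nonneg space_mu by (intro AE_I2) auto
    have "(LINT x|\<mu>. LINT y|K x. w y) = (LINT x|\<mu>. w x)"
      using integral_eq_nn_integral[OF Kw AE] eq w_int_nonneg by simp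
    moreover have "integrable \<mu> (\<lambda>x. LINT y|K x. w y)"
      by (rule integrableI_nonneg[OF Kw AE]) (simp add: eq)
    ultimately show ?thesis by blast
  qed
  have CV: "0 \<le> C * V x" if "x \<in> space M" for x using bound[OF that] by linarith
  define w where "w = (\<lambda>x. u x + C * V x)"
  have w: "w \<in> borel_measurable M" by (simp add: w_def)
  have w_bound: "0 \<le> w x \<and> w x \<le> (2 * C) * V x" if "x \<in> space M" for x
    using bound[OF that] by (auto simp: w_def)
  have int_u: "integrable (K x) u" if x: "x \<in> space M" for x
    by (rule Bochner_Integration.integrable_bound[of _ "\<lambda>y. C * V y"])
      (use integrable_V[OF x] measurable_K[OF x u] bound CV space_K[OF x] in \<open>auto intro!: AE_I2\<close>)
  have int_u_mu: "integrable \<mu> u"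
    by (rule Bochner_Integration.integrable_bound[of _ "\<lambda>y. C * V y"])
      (use integrable_V_mu measurable_mu[OF u] bound CV space_mu in \<open>auto intro!: AE_I2\<close>)
  note A = nonneg_case[OF w w_bound]
  have V_case: "(LINT x|\<mu>. LINT y|K x. C * V y) = (LINT x|\<mu>. C * V x) \<and> integrable \<mu> (\<lambda>x. LINT y|K x. C * V y)"
    by (rule nonneg_case[where D = C]) (use CV in auto)
  have "(LINT x|\<mu>. LINT y|K x. u y) = (LINT x|\<mu>. (LINT y|K x. w y) - (LINT y|K x. C * V y))"
    using int_u integrable_V space_mu by (intro Bochner_Integration.integral_cong) (auto simp: w_def)
  also have "\<dots> = (LINT x|\<mu>. w x) - (LINT x|\<mu>. C * V x)"
    using A V_case by (subst Bochner_Integration.integral_diff) auto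
  also have "\<dots> = (LINT x|\<mu>. u x)"
    using int_u_mu integrable_V_mu by (simp add: w_def)
  finally show ?thesis .
qed

lemma integral_mu_T:
  assumes f: "f \<in> wspace M V"
  shows "(LINT x|\<mu>. T f x) = (LINT x|\<mu>. f x)"
proof -
  obtain C where C: "0 \<le> C" "f \<in> wball M V C" using wspace_V_cases[OF f] by blast
  have [measurable]: "f \<in> borel_measurable M" using wballD(1)[OF C(2)] .
  have int_T: "integrable \<mu> (T f)" using integrable_mu T_wspace f by blast
  note int = integrable_K[OF _ f] integrable_mu[OF f]
  have Re: "\<bar>Re (f x)\<bar> \<le> C * V x" and Im: "\<bar>Im (f x)\<bar> \<le> C * V x" if "x \<in> space M" for x
    using wballD(2)[OF C(2) that] abs_Re_le_cmod abs_Im_le_cmod order_trans by blast+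
  show ?thesis
  proof (rule complex_eqI)
    have "Re (LINT x|\<mu>. T f x) = (LINT x|\<mu>. Re (T f x))" using int_T by simp
    also have "\<dots> = (LINT x|\<mu>. LINT y|K x. Re (f y))"
      using int space_mu by (intro Bochner_Integration.integral_cong) (auto simp: kernel_op_def)
    also have "\<dots> = (LINT x|\<mu>. Re (f x))"
      by (rule integral_mu_real[where C = C]) (use Re in auto)
    finally show "Re (LINT x|\<mu>. T f x) = Re (LINT x|\<mu>. f x)" using int by simp
    have "Im (LINT x|\<mu>. T f x) = (LINT x|\<mu>. Im (T f x))" using int_T by simp
    also have "\<dots> = (LINT x|\<mu>. LINT y|K x. Im (f y))"
      using int space_mu by (intro Bochner_Integration.integral_cong) (auto simp: kernel_op_def)
    also have "\<dots> = (LINT x|\<mu>. Im (f x))"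
      by (rule integral_mu_real[where C = C]) (use Im in auto)
    finally show "Im (LINT x|\<mu>. T f x) = Im (LINT x|\<mu>. f x)" using int by simp
  qed
qed

end

locale spectral_kernel = invariant_kernel M V K \<delta> L \<mu> for M :: "'a measure" and V K \<delta> L \<mu> +
  fixes \<phi> :: "'a \<Rightarrow> real"
  assumes phi_meas [measurable]: "\<phi> \<in> borel_measurable M"
    and phi_nonneg: "\<And>x. x \<in> space M \<Longrightarrow> 0 \<le> \<phi> x"
    and phi_bounded: "\<exists>b. \<forall>x\<in>space M. \<phi> x \<le> b"
    and phi_invariant: "\<And>x. x \<in> space M \<Longrightarrow> (LINT y|K x. \<phi> y) = \<phi> x"
    and phi_normalized: "(LINT x|\<mu>. \<phi> x) = 1"
begin

abbreviation proj :: "('a \<Rightarrow> complex) \<Rightarrow> 'a \<Rightarrow> complex" where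
  "proj \<equiv> rank_one_op M \<mu> \<phi>"

text \<open>
  The deviation of the iterates from their limit.
\<close>

definition dev :: "nat \<Rightarrow> ('a \<Rightarrow> complex) \<Rightarrow> 'a \<Rightarrow> complex" where
  "dev n f = (\<lambda>x. (T ^^ n) f x - proj f x)"

definition \<Phi> :: "'a \<Rightarrow> complex" where
  "\<Phi> = (\<lambda>x. if x \<in> space M then complex_of_real (\<phi> x) else 0)"

lemma proj_eq: "proj f = (\<lambda>x. (LINT y|\<mu>. f y) * \<Phi> x)"
  by (auto simp: rank_one_op_def \<Phi>_def)

lemma Phi_wball: obtains b where "0 \<le> b" "\<Phi> \<in> wball M (\<lambda>_. 1) b"
proof -
  obtain b where b: "\<forall>x\<in>space M. \<phi> x \<le> b" using phi_bounded by blast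
  have "\<Phi> \<in> wball M (\<lambda>_. 1) b"
    unfolding \<Phi>_def by (rule wballI) (use b phi_nonneg in auto)
  then show ?thesis using that wball_nonneg[OF _ weight_1] by blast
qed

lemma Phi_wspace: "\<Phi> \<in> wspace M V"
  using Phi_wball wball_1_in_wspace by metis

lemma T_Phi: "T \<Phi> = \<Phi>"
proof
  fix x
  show "T \<Phi> x = \<Phi> x"
  proof (cases "x \<in> space M")
    case True
    have "(LINT y|K x. \<Phi> y) = (LINT y|K x. complex_of_real (\<phi> y))"
      by (rule Bochner_Integration.integral_cong) (auto simp: \<Phi>_def space_K[OF True])
    then have "T \<Phi> x = (LINT y|K x. complex_of_real (\<phi> y))"
      using True by (simp add: kernel_op_def)
    then show ?thesis using True phi_invariant[OF True] by (simp add: \<Phi>_def)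
  qed (simp add: kernel_op_def \<Phi>_def)
qed

lemma integral_Phi: "(LINT x|\<mu>. \<Phi> x) = 1"
proof -
  have "(LINT x|\<mu>. \<Phi> x) = (LINT x|\<mu>. complex_of_real (\<phi> x))"
    by (rule Bochner_Integration.integral_cong) (auto simp: \<Phi>_def space_mu)
  then show ?thesis by (simp add: phi_normalized)
qed

lemma proj_wspace: "proj f \<in> wspace M V"
  unfolding proj_eq by (rule wspace_scale[OF Phi_wspace])

lemma proj_wball: obtains D where "0 \<le> D" "\<And>f C. f \<in> wball M V C \<Longrightarrow> proj f \<in> wball M V (C * D)"
proof -
  obtain b where b: "0 \<le> b" "\<Phi> \<in> wball M (\<lambda>_. 1) b" using Phi_wball .
  have v: "0 \<le> (LINT x|\<mu>. V x)" using V_nonneg_AE_mu by (rule integral_nonneg_AE)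
  show ?thesis
  proof (rule that)
    show "0 \<le> (LINT x|\<mu>. V x) * b" using v b by simp
    fix f C assume f: "f \<in> wball M V C"
    have "proj f \<in> wball M V (cmod (LINT y|\<mu>. f y) * b)"
      unfolding proj_eq by (rule wball_scale[OF wball_weight_V[OF b(2) weight_1]])
    then show "proj f \<in> wball M V (C * ((LINT x|\<mu>. V x) * b))"
      by (rule wball_increase)
        (use integral_mu_bound_V[OF f] b in \<open>auto simp: mult.assoc[symmetric] intro: mult_right_mono\<close>)
  qed
qed

lemma proj_add: "f \<in> wspace M V \<Longrightarrow> g \<in> wspace M V \<Longrightarrow> proj (\<lambda>x. f x + g x) = (\<lambda>x. proj f x + proj g x)"
  using integrable_mu by (auto simp: proj_eq distrib_right)

lemma proj_diff: "f \<in> wspace M V \<Longrightarrow> g \<in> wspace M V \<Longrightarrow> proj (\<lambda>x. f x - g x) = (\<lambda>x. proj f x - proj g x)"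
  using integrable_mu by (auto simp: proj_eq left_diff_distrib)

lemma proj_scale: "proj (\<lambda>x. a * f x) = (\<lambda>x. a * proj f x)"
  by (auto simp: proj_eq)

lemma proj_T: "f \<in> wspace M V \<Longrightarrow> proj (T f) = proj f"
  by (simp add: proj_eq integral_mu_T)

lemma T_proj: "T (proj f) = proj f"
  unfolding proj_eq by (simp add: T_scale T_Phi)

lemma proj_proj: "proj (proj f) = proj f"
  by (simp add: proj_eq integral_Phi)

lemma proj_iter: "f \<in> wspace M V \<Longrightarrow> proj ((T ^^ n) f) = proj f"
  by (induction n) (auto simp: proj_T iter_wspace)

lemma iter_proj: "(T ^^ n) (proj f) = proj f"
  by (induction n) (auto simp: T_proj)

lemma dev_wspace: "f \<in> wspace M V \<Longrightarrow> dev n f \<in> wspace M V"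
  unfolding dev_def by (intro wspace_diff iter_wspace proj_wspace)

lemma dev_add: "f \<in> wspace M V \<Longrightarrow> g \<in> wspace M V \<Longrightarrow> dev n (\<lambda>x. f x + g x) = (\<lambda>x. dev n f x + dev n g x)"
  by (simp add: dev_def iter_add proj_add algebra_simps)

lemma dev_diff: "f \<in> wspace M V \<Longrightarrow> g \<in> wspace M V \<Longrightarrow> dev n (\<lambda>x. f x - g x) = (\<lambda>x. dev n f x - dev n g x)"
  by (simp add: dev_def iter_diff proj_diff algebra_simps)

lemma dev_scale: "dev n (\<lambda>x. a * f x) = (\<lambda>x. a * dev n f x)"
  by (simp add: dev_def iter_scale proj_scale right_diff_distrib)

lemma dev_T: "f \<in> wspace M V \<Longrightarrow> dev n (T f) = dev (Suc n) f"
  by (simp add: dev_def proj_T funpow_swap1)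

lemma T_dev: "f \<in> wspace M V \<Longrightarrow> T (dev n f) = dev (Suc n) f"
  by (simp add: dev_def T_diff iter_wspace proj_wspace T_proj)

text \<open>
  The powers of \<open>T\<close> minus the projection form a semigroup, because the projection absorbs \<open>T\<close>
  on both sides and is idempotent.
\<close>

lemma dev_dev:
  assumes "f \<in> wspace M V" shows "dev n (dev m f) = dev (n + m) f"
proof -
  have "(T ^^ n) (dev m f) = (\<lambda>x. (T ^^ (n + m)) f x - proj f x)"
    using iter_diff[OF iter_wspace[OF assms] proj_wspace] by (simp add: dev_def iter_proj funpow_add)
  moreover have "proj (dev m f) = (\<lambda>x. 0)"
    using proj_diff[OF iter_wspace[OF assms] proj_wspace] by (simp add: dev_def proj_iter[OF assms] proj_proj)
  ultimately show ?thesis by (simp add: dev_def)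
qed

definition rate :: "real \<Rightarrow> real \<Rightarrow> bool" where
  "rate C t \<longleftrightarrow> (\<forall>n f D. f \<in> wball M V D \<longrightarrow> dev n f \<in> wball M V (C * t ^ n * D))"

lemma rateD: "rate C t \<Longrightarrow> f \<in> wball M V D \<Longrightarrow> dev n f \<in> wball M V (C * t ^ n * D)"
  by (simp add: rate_def)

lemma V_geom_ergodic_rate:
  assumes "V_geom_ergodic M V K \<mu> \<phi> t"
  obtains C where "0 < C" "rate C t"
proof -
  obtain C where C: "0 < C" "\<And>n. opnorm1 M V (dev n) \<le> C * t ^ n"
    using assms unfolding V_geom_ergodic_def dev_def by blast
  obtain D where D: "0 \<le> D" "\<And>f C. f \<in> wball M V C \<Longrightarrow> proj f \<in> wball M V (C * D)"
    using proj_wball by blast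
  have "dev n f \<in> wball M V (C * t ^ n * E)" if f: "f \<in> wball M V E" for n f E
  proof -
    have "dev n f \<in> wball M V (opnorm1 M V (dev n) * E)"
    proof (rule opnorm_wball[OF weight_V weight_V _ _ f])
      show "dev n g \<in> wball M V (1 * (1 + L / (1 - \<delta>)) + 1 * D)" if "g \<in> wball M V 1" for g
        unfolding dev_def by (intro wball_diff iter_wball_V D that)
    qed (rule dev_scale)
    then show ?thesis
      by (rule wball_increase) (use C wball_nonneg[OF f] in \<open>auto intro: mult_right_mono\<close>)
  qed
  then show ?thesis using that C(1) by (auto simp: rate_def)
qed

end

section \<open>The resolvent as a series\<close>

text \<open>
  Coefficients of size \<open>t ^ n\<close> make the series of a resolvent and of its square converge for
  \<open>\<bar>z\<bar> > t\<close>. The two limits are the boundary terms of the telescoping sums below.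
\<close>

lemma geometric_series_bounds:
  fixes a :: "nat \<Rightarrow> complex"
  assumes a: "\<And>n. cmod (a n) \<le> C * t ^ n" and t: "0 < t" "t < cmod z"
  shows "summable (\<lambda>n. a n / z ^ Suc n)"
    and "cmod (\<Sum>n. a n / z ^ Suc n) \<le> C / (cmod z - t)"
    and "summable (\<lambda>n. of_nat (Suc n) * a n / z ^ Suc (Suc n))"
    and "cmod (\<Sum>n. of_nat (Suc n) * a n / z ^ Suc (Suc n)) \<le> C / (cmod z - t)\<^sup>2"
    and "(\<lambda>n. a n / z ^ n) \<longlonglongrightarrow> 0"
    and "(\<lambda>n. of_nat n * a n / z ^ Suc n) \<longlonglongrightarrow> 0"
proof -
  define q where "q = t / cmod z"
  have z: "0 < cmod z" using t by linarith
  have q: "0 < q" "q < 1" using t z by (auto simp: q_def)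
  have C: "0 \<le> C" using order_trans[OF norm_ge_zero a[of 0]] by simp
  have b: "cmod (a n / z ^ n) \<le> C * q ^ n" for n
    using a[of n] z by (simp add: norm_divide norm_power q_def power_divide divide_right_mono)
  have b1: "cmod (a n / z ^ Suc n) \<le> C / cmod z * q ^ n" for n
    using divide_right_mono[OF b[of n], of "cmod z"] z by (simp add: norm_divide norm_mult field_simps)
  have b2: "cmod (of_nat (Suc n) * a n / z ^ Suc (Suc n)) \<le> C / (cmod z)\<^sup>2 * (of_nat (Suc n) * q ^ n)" for n
  proof -
    have "cmod (of_nat (Suc n) * a n / z ^ Suc (Suc n)) = of_nat (Suc n) * cmod (a n / z ^ Suc n) / cmod z"
      by (simp add: norm_divide norm_mult norm_power del: of_nat_Suc)
    also have "\<dots> \<le> of_nat (Suc n) * (C / cmod z * q ^ n) / cmod z"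
      using b1[of n] z by (intro divide_right_mono mult_left_mono) auto
    finally show ?thesis by (simp add: power2_eq_square field_simps)
  qed
  have s1: "(\<lambda>n. C / cmod z * q ^ n) sums (C / cmod z * (1 / (1 - q)))"
    using geometric_sums[of q] q by (intro sums_mult) auto
  have s2: "(\<lambda>n. C / (cmod z)\<^sup>2 * (of_nat (Suc n) * q ^ n)) sums (C / (cmod z)\<^sup>2 * (1 / (1 - q)\<^sup>2))"
    using geometric_deriv_sums[of q] q by (intro sums_mult) auto
  show "summable (\<lambda>n. a n / z ^ Suc n)"
    by (rule summable_comparison_test'[OF sums_summable[OF s1] b1])
  show "summable (\<lambda>n. of_nat (Suc n) * a n / z ^ Suc (Suc n))"
    by (rule summable_comparison_test'[OF sums_summable[OF s2] b2])
  have "cmod (\<Sum>n. a n / z ^ Suc n) \<le> C / cmod z * (1 / (1 - q))"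
    using norm_suminf_le[OF b1 sums_summable[OF s1]] sums_unique[OF s1] by simp
  also have "\<dots> = C / (cmod z - t)" using z t by (simp add: q_def field_simps)
  finally show "cmod (\<Sum>n. a n / z ^ Suc n) \<le> C / (cmod z - t)" .
  have "cmod (\<Sum>n. of_nat (Suc n) * a n / z ^ Suc (Suc n)) \<le> C / (cmod z)\<^sup>2 * (1 / (1 - q)\<^sup>2)"
    using norm_suminf_le[OF b2 sums_summable[OF s2]] sums_unique[OF s2] by simp
  also have "\<dots> = C / (cmod z - t)\<^sup>2"
    using z t by (simp add: q_def diff_divide_distrib[symmetric] power_divide divide_simps)
  finally show "cmod (\<Sum>n. of_nat (Suc n) * a n / z ^ Suc (Suc n)) \<le> C / (cmod z - t)\<^sup>2" .
  have "(\<lambda>n. C * q ^ n) \<longlonglongrightarrow> C * 0"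
    using q by (intro tendsto_mult_left LIMSEQ_power_zero) auto
  then show "(\<lambda>n. a n / z ^ n) \<longlonglongrightarrow> 0"
    by (intro Lim_null_comparison[OF always_eventually[OF allI[OF b]]]) simp
  have "(\<lambda>n. C / cmod z * (of_nat n * q ^ n)) \<longlonglongrightarrow> C / cmod z * 0"
    using q by (intro tendsto_mult_left powser_times_n_limit_0) auto
  moreover have "cmod (of_nat n * a n / z ^ Suc n) \<le> C / cmod z * (of_nat n * q ^ n)" for n
  proof -
    have "cmod (of_nat n * a n / z ^ Suc n) = of_nat n * cmod (a n / z ^ Suc n)"
      by (simp add: norm_divide norm_mult)
    also have "\<dots> \<le> of_nat n * (C / cmod z * q ^ n)"
      using b1[of n] by (intro mult_left_mono) auto
    finally show ?thesis by (simp add: field_simps)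
  qed
  ultimately show "(\<lambda>n. of_nat n * a n / z ^ Suc n) \<longlonglongrightarrow> 0"
    using Lim_null_comparison[OF always_eventually, of "\<lambda>n. of_nat n * a n / z ^ Suc n"
        "\<lambda>n. C / cmod z * (of_nat n * q ^ n)" sequentially] by simp
qed

context spectral_kernel
begin

text \<open>
  The value at \<open>x\<close> of \<open>(z - T)\<^sup>-\<^sup>1 f\<close>: a Neumann series on the complement of the invariant
  direction, and the pole at 1 on that direction.
\<close>

definition res :: "complex \<Rightarrow> 'a \<Rightarrow> ('a \<Rightarrow> complex) \<Rightarrow> complex" where
  "res z x f = (\<Sum>n. dev n f x / z ^ Suc n) + proj f x / (z - 1)"

text \<open>
  The value at \<open>x\<close> of \<open>(z - T)\<^sup>-\<^sup>2 f\<close>, that is, minus the derivative of \<open>res\<close> in \<open>z\<close>.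
\<close>

definition res_sq :: "complex \<Rightarrow> 'a \<Rightarrow> ('a \<Rightarrow> complex) \<Rightarrow> complex" where
  "res_sq z x f = (\<Sum>n. of_nat (Suc n) * dev n f x / z ^ Suc (Suc n)) + proj f x / (z - 1)\<^sup>2"

context
  fixes C t :: real
  assumes rate: "rate C t" and t: "0 < t"
begin

lemma dev_bound: "f \<in> wball M V D \<Longrightarrow> x \<in> space M \<Longrightarrow> cmod (dev n f x) \<le> C * D * V x * t ^ n"
  using wballD(2)[OF rateD[OF rate], of f D x n] by (simp add: mult_ac)

lemma dev_outside: "f \<in> wspace M V \<Longrightarrow> x \<notin> space M \<Longrightarrow> dev n f x = 0"
  using dev_wspace[of f n] by (simp add: wspace_def)

lemma dev_bound_wspace:
  assumes "f \<in> wspace M V"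
  obtains E where "\<And>n. cmod (dev n f x) \<le> E * t ^ n"
proof -
  obtain D where "0 \<le> D" "f \<in> wball M V D" using wspace_V_cases[OF assms] by blast
  then show ?thesis
    using that[of "C * D * V x"] that[of 0] dev_bound[of f D x] dev_outside[OF assms, of x]
    by (cases "x \<in> space M") auto
qed

lemma summable_res:
  assumes "f \<in> wspace M V" "t < cmod z"
  shows "summable (\<lambda>n. dev n f x / z ^ Suc n)"
    and "summable (\<lambda>n. of_nat (Suc n) * dev n f x / z ^ Suc (Suc n))"
proof -
  obtain E where "\<And>n. cmod (dev n f x) \<le> E * t ^ n" using dev_bound_wspace[OF assms(1)] by blast
  note geometric_series_bounds[OF this t assms(2)]
  then show "summable (\<lambda>n. dev n f x / z ^ Suc n)"
    and "summable (\<lambda>n. of_nat (Suc n) * dev n f x / z ^ Suc (Suc n))" by blast+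
qed

lemma dev_shift:
  assumes f: "f \<in> wspace M V"
  shows "dev n (\<lambda>x. z * f x - T f x) x = z * dev n f x - dev (Suc n) f x"
  using dev_diff[OF wspace_scale[OF f] T_wspace[OF f]] by (simp add: dev_scale dev_T[OF f])

lemma proj_shift:
  assumes f: "f \<in> wspace M V"
  shows "proj (\<lambda>x. z * f x - T f x) x = (z - 1) * proj f x"
  using proj_diff[OF wspace_scale[OF f] T_wspace[OF f]]
  by (simp add: proj_scale proj_T[OF f] algebra_simps)

text \<open>
  The two functionals invert \<open>z - T\<close> from the appropriate side, once and twice. The deviation
  of \<open>z * f - T f\<close> is \<open>z * dev n f - dev (Suc n) f\<close>, so the series telescope; on the range of the projection
  \<open>z - T\<close> is multiplication by \<open>z - 1\<close>.
\<close>

lemma res_shift: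
  assumes f: "f \<in> wspace M V" and z: "t < cmod z" "z \<noteq> 1"
  shows "res z x (\<lambda>x. z * f x - T f x) = f x"
    and "res_sq z x (\<lambda>x. z * f x - T f x) = res z x f"
proof -
  obtain E where E: "\<And>n. cmod (dev n f x) \<le> E * t ^ n" using dev_bound_wspace[OF f] by blast
  have z0: "z \<noteq> 0" using z t by auto
  have "(\<lambda>n. dev n f x / z ^ n - dev (Suc n) f x / z ^ Suc n) sums (dev 0 f x / z ^ 0 - 0)"
    by (rule telescope_sums'[OF geometric_series_bounds(5)[OF E t z(1)]])
  moreover have "dev n f x / z ^ n - dev (Suc n) f x / z ^ Suc n = dev n (\<lambda>x. z * f x - T f x) x / z ^ Suc n" for n
    using z0 by (simp add: dev_shift[OF f] field_simps)
  ultimately have "(\<Sum>n. dev n (\<lambda>x. z * f x - T f x) x / z ^ Suc n) = dev 0 f x"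
    by (simp add: sums_iff)
  then show "res z x (\<lambda>x. z * f x - T f x) = f x"
    using z(2) by (simp add: res_def proj_shift[OF f] dev_def)
  have "(\<lambda>n. of_nat n * dev n f x / z ^ Suc n - of_nat (Suc n) * dev (Suc n) f x / z ^ Suc (Suc n))
      sums (of_nat 0 * dev 0 f x / z ^ Suc 0 - 0)"
    by (rule telescope_sums'[OF geometric_series_bounds(6)[OF E t z(1)]])
  from sums_add[OF summable_sums[OF summable_res(1)[OF f z(1), where x = x]] this]
  have "(\<lambda>n. dev n f x / z ^ Suc n + (of_nat n * dev n f x / z ^ Suc n
      - of_nat (Suc n) * dev (Suc n) f x / z ^ Suc (Suc n))) sums (\<Sum>n. dev n f x / z ^ Suc n)"
    by simp
  moreover have "dev n f x / z ^ Suc n + (of_nat n * dev n f x / z ^ Suc n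
      - of_nat (Suc n) * dev (Suc n) f x / z ^ Suc (Suc n))
      = of_nat (Suc n) * dev n (\<lambda>x. z * f x - T f x) x / z ^ Suc (Suc n)" for n
    using z0 by (simp add: dev_shift[OF f] field_simps)
  ultimately have "(\<Sum>n. of_nat (Suc n) * dev n (\<lambda>x. z * f x - T f x) x / z ^ Suc (Suc n))
      = (\<Sum>n. dev n f x / z ^ Suc n)"
    by (simp add: sums_iff)
  then show "res_sq z x (\<lambda>x. z * f x - T f x) = res z x f"
    using z(2) by (simp add: res_def res_sq_def proj_shift[OF f] power2_eq_square)
qed

lemma res_functional:
  assumes x: "x \<in> space M" and z: "t < cmod z"
  shows "bounded_functional M V (res z x)" and "bounded_functional M V (res_sq z x)"
proof -
  obtain D where D: "0 \<le> D" "\<And>f C. f \<in> wball M V C \<Longrightarrow> proj f \<in> wball M V (C * D)"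
    using proj_wball by blast
  have proj_bound: "cmod (proj f x) \<le> D * V x" if "f \<in> wball M V 1" for f
    using wballD(2)[OF D(2)[OF that] x] by simp
  show "bounded_functional M V (res z x)"
  proof (unfold_locales)
    fix f g assume fg: "f \<in> wspace M V" "g \<in> wspace M V"
    show "res z x (\<lambda>x. f x + g x) = res z x f + res z x g"
      unfolding res_def
      by (simp add: dev_add[OF fg] proj_add[OF fg] add_divide_distrib
          suminf_add[OF summable_res(1)[OF fg(1) z] summable_res(1)[OF fg(2) z], symmetric] del: power_Suc)
  next
    fix a f assume f: "f \<in> wspace M V"
    show "res z x (\<lambda>x. a * f x) = a * res z x f"
      unfolding res_def
      by (simp add: dev_scale proj_scale distrib_left suminf_mult[OF summable_res(1)[OF f z], symmetric] del: power_Suc)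
  next
    show "\<exists>C. \<forall>f\<in>wball M V 1. cmod (res z x f) \<le> C"
    proof (intro exI ballI)
      fix f assume f: "f \<in> wball M V 1"
      show "cmod (res z x f) \<le> C * 1 * V x / (cmod z - t) + D * V x / cmod (z - 1)"
        unfolding res_def
        using geometric_series_bounds(2)[OF dev_bound[OF f x] t z] proj_bound[OF f]
        by (intro norm_triangle_mono) (auto simp: norm_divide divide_right_mono)
    qed
  qed
  show "bounded_functional M V (res_sq z x)"
  proof (unfold_locales)
    fix f g assume fg: "f \<in> wspace M V" "g \<in> wspace M V"
    show "res_sq z x (\<lambda>x. f x + g x) = res_sq z x f + res_sq z x g"
      unfolding res_sq_def
      by (simp add: dev_add[OF fg] proj_add[OF fg] add_divide_distrib distrib_left
          suminf_add[OF summable_res(2)[OF fg(1) z] summable_res(2)[OF fg(2) z], symmetric] del: of_nat_Suc power_Suc)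
  next
    fix a f assume f: "f \<in> wspace M V"
    have "of_nat (Suc n) * dev n (\<lambda>x. a * f x) x / z ^ Suc (Suc n)
        = a * (of_nat (Suc n) * dev n f x / z ^ Suc (Suc n))" for n
      by (simp add: dev_scale)
    then show "res_sq z x (\<lambda>x. a * f x) = a * res_sq z x f"
      unfolding res_sq_def
      by (simp only: suminf_mult[OF summable_res(2)[OF f z]]) (simp add: proj_scale distrib_left)
  next
    show "\<exists>C. \<forall>f\<in>wball M V 1. cmod (res_sq z x f) \<le> C"
    proof (intro exI ballI)
      fix f assume f: "f \<in> wball M V 1"
      show "cmod (res_sq z x f) \<le> C * 1 * V x / (cmod z - t)\<^sup>2 + D * V x / (cmod (z - 1))\<^sup>2"
        unfolding res_sq_def
        using geometric_series_bounds(4)[OF dev_bound[OF f x] t z] proj_bound[OF f]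
        by (intro norm_triangle_mono) (auto simp: norm_divide norm_power divide_right_mono)
    qed
  qed
qed

end

end

section \<open>Spectrum and resolvent of a geometrically ergodic kernel\<close>

context spectral_kernel
begin

text \<open>
  The invariant function \<open>\<Phi>\<close> is a nonzero eigenfunction, as it has integral 1.
\<close>

lemma one_in_spectrum: "1 \<in> spectrum M V T"
proof -
  have False if R: "bounded_op M V R"
      "\<forall>f\<in>wspace M V. R (\<lambda>x. 1 * f x - T f x) = f \<and> (\<lambda>x. 1 * R f x - T (R f) x) = f" for R
  proof -
    have "R (\<lambda>x. 0) = \<Phi>" using R(2)[rule_format, OF Phi_wspace] by (simp add: T_Phi)
    moreover have "R (\<lambda>x. 0 * \<Phi> x) = (\<lambda>x. 0 * R \<Phi> x)"
      using R(1) Phi_wspace unfolding bounded_op_def by blast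
    ultimately have "\<Phi> = (\<lambda>x. 0)" by simp
    then show False using integral_Phi by simp
  qed
  then show ?thesis unfolding spectrum_def by blast
qed

definition resolvent_series :: "complex \<Rightarrow> ('a \<Rightarrow> complex) \<Rightarrow> 'a \<Rightarrow> complex" where
  "resolvent_series z f = (\<lambda>x. if x \<in> space M then res z x f else 0)"

context
  fixes C t :: real
  assumes rate: "rate C t" and t: "0 < t"
begin

lemma resolvent_series_left_inverse:
  assumes "f \<in> wspace M V" "t < cmod z" "z \<noteq> 1"
  shows "resolvent_series z (\<lambda>x. z * f x - T f x) = f"
  using res_shift(1)[OF rate t assms] assms(1) by (auto simp: resolvent_series_def wspace_def)

lemma resolvent_series_wball:
  assumes D: "0 \<le> D" "\<And>f E. f \<in> wball M V E \<Longrightarrow> proj f \<in> wball M V (E * D)"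
    and f: "f \<in> wball M V E" and z: "t < cmod z"
  shows "resolvent_series z f \<in> wball M V ((C / (cmod z - t) + D / cmod (z - 1)) * E)"
proof (rule wballI)
  have fV: "f \<in> wspace M V" using wball_V_in_wspace[OF f] .
  have [measurable]: "dev n f \<in> borel_measurable M" "proj f \<in> borel_measurable M" for n
    using dev_wspace[OF fV] proj_wspace[of f] by (auto simp: wspace_def)
  show "resolvent_series z f \<in> borel_measurable M" unfolding resolvent_series_def res_def by measurable
  fix x assume x: "x \<in> space M"
  have "cmod (res z x f) \<le> C * E * V x / (cmod z - t) + E * D * V x / cmod (z - 1)"
    unfolding res_def
    using geometric_series_bounds(2)[OF dev_bound[OF rate t f x] t z] wballD(2)[OF D(2)[OF f] x]
    by (intro norm_triangle_mono) (auto simp: norm_divide divide_right_mono)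
  then show "cmod (resolvent_series z f x) \<le> (C / (cmod z - t) + D / cmod (z - 1)) * E * V x"
    using x by (simp add: resolvent_series_def algebra_simps)
qed (simp add: resolvent_series_def)

lemma resolvent_series_wspace:
  assumes f: "f \<in> wspace M V" and z: "t < cmod z" shows "resolvent_series z f \<in> wspace M V"
proof -
  obtain D where D: "0 \<le> D" "\<And>f E. f \<in> wball M V E \<Longrightarrow> proj f \<in> wball M V (E * D)"
    using proj_wball by blast
  obtain E where "f \<in> wball M V E" using wspace_V_cases[OF f] by blast
  then show ?thesis using resolvent_series_wball[OF D _ z] wball_V_in_wspace by blast
qed

text \<open>
  The kernel may be integrated term by term, the series being dominated by a geometric multiple of the
  integrable function \<open>V\<close>.
\<close>

lemma T_resolvent_series:
  assumes f: "f \<in> wspace M V" and z: "t < cmod z"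
  shows "T (resolvent_series z f) = resolvent_series z (T f)"
proof
  fix x
  show "T (resolvent_series z f) x = resolvent_series z (T f) x"
  proof (cases "x \<in> space M")
    case x: True
    obtain E where E: "0 \<le> E" "f \<in> wball M V E" using wspace_V_cases[OF f] by blast
    define h where "h = (\<lambda>n y. dev n f y / z ^ Suc n)"
    have int_dev: "integrable (K x) (dev n f)" for n by (rule integrable_K[OF x dev_wspace[OF f]])
    have int_h: "integrable (K x) (h n)" for n
      unfolding h_def using int_dev by simp
    have AE: "AE y in K x. summable (\<lambda>n. norm (h n y))"
    proof (rule AE_I2)
      fix y assume "y \<in> space (K x)"
      then have y: "y \<in> space M" using space_K[OF x] by simp
      have "cmod (cmod (dev n f y)) \<le> C * E * V y * t ^ n" for n
        using dev_bound[OF rate t E(2) y] by simp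
      then have "summable (\<lambda>n. complex_of_real (cmod (dev n f y)) / complex_of_real (cmod z) ^ Suc n)"
        using z by (intro geometric_series_bounds(1)[OF _ t]) auto
      then have "summable (\<lambda>n. complex_of_real (cmod (h n y)))"
        by (simp add: h_def norm_divide norm_mult norm_power)
      then show "summable (\<lambda>n. norm (h n y))" by (simp only: summable_of_real_iff)
    qed
    have sum_int: "summable (\<lambda>n. LINT y|K x. norm (h n y))"
    proof (rule summable_comparison_test'[where N = 0])
      define J where "J = (LINT y|K x. V y)"
      have J: "0 \<le> J"
        unfolding J_def using V_nonneg space_K[OF x] by (intro integral_nonneg_AE AE_I2) auto
      show "summable (\<lambda>n. C * E * J / cmod z * (t / cmod z) ^ n)"
        using t z order.strict_trans[OF t z] by (intro summable_mult summable_geometric) simp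
      fix n
      have "(LINT y|K x. norm (h n y)) \<le> (LINT y|K x. (C * E * t ^ n / cmod z ^ Suc n) * V y)"
      proof (rule integral_mono)
        fix y assume "y \<in> space (K x)"
        then have y: "y \<in> space M" using space_K[OF x] by simp
        show "norm (h n y) \<le> C * E * t ^ n / cmod z ^ Suc n * V y"
          using divide_right_mono[OF dev_bound[OF rate t E(2) y, of n], of "cmod z ^ Suc n"]
          by (simp add: h_def norm_divide norm_mult norm_power mult_ac)
      qed (use int_h integrable_V[OF x] in auto)
      also have "\<dots> = C * E * J / cmod z * (t / cmod z) ^ n"
        by (simp add: J_def power_divide mult_ac)
      finally show "norm (LINT y|K x. norm (h n y)) \<le> C * E * J / cmod z * (t / cmod z) ^ n"
        by simp
    qed
    have integral_h: "(LINT y|K x. h n y) = dev n (T f) x / z ^ Suc n" for n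
    proof -
      have "(LINT y|K x. dev n f y) = T (dev n f) x" using x by (simp add: kernel_op_def)
      then show ?thesis by (simp add: h_def T_dev[OF f] dev_T[OF f])
    qed
    have proj_int: "(LINT y|K x. proj f y) = proj (T f) x"
    proof -
      have "(LINT y|K x. proj f y) = T (proj f) x" using x by (simp add: kernel_op_def)
      then show ?thesis by (simp add: T_proj proj_T[OF f])
    qed
    have "T (resolvent_series z f) x = (LINT y|K x. (\<Sum>n. h n y) + proj f y / (z - 1))"
      using x space_K[OF x]
      by (auto simp: kernel_op_def resolvent_series_def res_def h_def intro!: Bochner_Integration.integral_cong)
    also have "\<dots> = (LINT y|K x. (\<Sum>n. h n y)) + (LINT y|K x. proj f y / (z - 1))"
      using integrable_K[OF x proj_wspace]
      by (intro Bochner_Integration.integral_add integrable_suminf[OF int_h AE sum_int]) simp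
    also have "(LINT y|K x. (\<Sum>n. h n y)) = (\<Sum>n. LINT y|K x. h n y)"
      by (rule integral_suminf[OF int_h AE sum_int])
    finally show ?thesis using x by (simp add: resolvent_series_def res_def integral_h proj_int)
  qed (simp add: kernel_op_def resolvent_series_def)
qed

text \<open>
  Commutation with \<open>T\<close> turns the left inverse into a right inverse.
\<close>

lemma resolvent_series_right_inverse:
  assumes f: "f \<in> wspace M V" and z: "t < cmod z" "z \<noteq> 1"
  shows "(\<lambda>x. z * resolvent_series z f x - T (resolvent_series z f) x) = f"
proof -
  have "resolvent_series z (\<lambda>x. z * f x - T f x) = (\<lambda>x. z * resolvent_series z f x - resolvent_series z (T f) x)"
  proof
    fix x
    show "resolvent_series z (\<lambda>x. z * f x - T f x) x = z * resolvent_series z f x - resolvent_series z (T f) x"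
    proof (cases "x \<in> space M")
      case True
      interpret m: bounded_functional M V "res z x" by (rule res_functional(1)[OF rate t True z(1)])
      show ?thesis using True f by (simp add: resolvent_series_def m.m_diff m.m_scale wspace_scale T_wspace)
    qed (simp add: resolvent_series_def)
  qed
  then show ?thesis using resolvent_series_left_inverse[OF f z] T_resolvent_series[OF f z(1)] by simp
qed

lemma resolvent_eq:
  assumes f: "f \<in> wspace M V" and z: "t < cmod z" "z \<noteq> 1"
  shows "resolvent M V T z f = resolvent_series z f"
proof -
  have "inj_on (\<lambda>f x. z * f x - T f x) (wspace M V)"
    by (rule inj_on_inverseI[where g = "resolvent_series z"]) (rule resolvent_series_left_inverse[OF _ z])
  then have "inv_into (wspace M V) (\<lambda>f x. z * f x - T f x) (\<lambda>x. z * resolvent_series z f x - T (resolvent_series z f) x) = resolvent_series z f"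
    by (rule inv_into_f_f) (rule resolvent_series_wspace[OF f z(1)])
  then show ?thesis by (simp add: resolvent_def resolvent_series_right_inverse[OF f z])
qed

lemma resolvent_series_scale:
  assumes "f \<in> wspace M V" "t < cmod z"
  shows "resolvent_series z (\<lambda>x. a * f x) = (\<lambda>x. a * resolvent_series z f x)"
proof
  fix x
  show "resolvent_series z (\<lambda>x. a * f x) x = a * resolvent_series z f x"
    using bounded_functional.m_scale[OF res_functional(1)[OF rate t _ assms(2)] assms(1)]
    by (simp add: resolvent_series_def)
qed

lemma resolvent_series_add:
  assumes "f \<in> wspace M V" "g \<in> wspace M V" "t < cmod z"
  shows "resolvent_series z (\<lambda>x. f x + g x) = (\<lambda>x. resolvent_series z f x + resolvent_series z g x)"
proof
  fix x
  show "resolvent_series z (\<lambda>x. f x + g x) x = resolvent_series z f x + resolvent_series z g x"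
    using bounded_functional.m_add[OF res_functional(1)[OF rate t _ assms(3)] assms(1,2)]
    by (simp add: resolvent_series_def)
qed

lemma spectrum_subset: "spectrum M V T \<subseteq> insert 1 (cball 0 t)"
proof
  fix z assume spec: "z \<in> spectrum M V T"
  show "z \<in> insert 1 (cball 0 t)"
  proof (rule ccontr)
    assume "z \<notin> insert 1 (cball 0 t)"
    then have z: "t < cmod z" "z \<noteq> 1" by auto
    obtain D where D: "0 \<le> D" "\<And>f E. f \<in> wball M V E \<Longrightarrow> proj f \<in> wball M V (E * D)"
      using proj_wball by blast
    have "bounded_op M V (resolvent_series z)"
      unfolding bounded_op_def
    proof (intro conjI)
      show "\<forall>f\<in>wspace M V. resolvent_series z f \<in> wspace M V" using resolvent_series_wspace z by blast
      show "\<forall>f\<in>wspace M V. \<forall>g\<in>wspace M V. resolvent_series z (\<lambda>x. f x + g x) = (\<lambda>x. resolvent_series z f x + resolvent_series z g x)"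
        using resolvent_series_add z by blast
      show "\<forall>a. \<forall>f\<in>wspace M V. resolvent_series z (\<lambda>x. a * f x) = (\<lambda>x. a * resolvent_series z f x)"
        using resolvent_series_scale z by blast
      show "\<exists>C. \<forall>f\<in>wspace M V. wnorm M V (resolvent_series z f) \<le> C * wnorm M V f"
        using resolvent_series_wball[OF D wspace_wball_wnorm[OF weight_V] z(1)]
          wnorm_le_iff[OF weight_V resolvent_series_wspace[OF _ z(1)]] by blast
    qed
    then show False
      using spec resolvent_series_left_inverse[OF _ z] resolvent_series_right_inverse[OF _ z] unfolding spectrum_def by blast
  qed
qed

text \<open>
  A point of the annulus has distance at least \<open>\<bar>z\<bar> - t\<close> from the disc and \<open>1 - \<bar>z\<bar>\<close> from the point 1,
  and these two contain the spectrum. That the spectrum is nonempty matters: the distance to the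
  empty set is 0 by convention.
\<close>

lemma not_in_spectral_nbhd:
  assumes z: "r < cmod z" "cmod z < 1 - \<theta>" and r: "t + \<theta> < r"
  shows "z \<notin> spectral_nbhd M V r \<theta> T"
proof -
  have "min (cmod z - t) (1 - cmod z) \<le> infdist z (spectrum M V T)"
  proof -
    have "min (cmod z - t) (1 - cmod z) \<le> dist z w" if w: "w \<in> spectrum M V T" for w
    proof -
      have "w = 1 \<or> cmod w \<le> t" using w spectrum_subset by auto
      moreover have "cmod z - cmod w \<le> dist z w" "cmod w - cmod z \<le> dist z w"
        using norm_triangle_ineq2[of z w] norm_triangle_ineq2[of w z]
        by (auto simp: dist_norm norm_minus_commute)
      ultimately show ?thesis by auto
    qed
    then show ?thesis
      unfolding infdist_def using one_in_spectrum by (auto intro!: cINF_greatest)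
  qed
  moreover have "\<theta> < min (cmod z - t) (1 - cmod z)" using z r by auto
  ultimately show ?thesis using z by (auto simp: spectral_nbhd_def)
qed

text \<open>
  The supremum \<open>H\<close> is a real supremum, so it is informative only because the resolvents are uniformly
  bounded off the spectral neighbourhood: there \<open>\<bar>z\<bar> - t\<close> is at least \<open>r - t\<close>, and \<open>\<bar>z - 1\<bar>\<close> is greater
  than \<open>\<theta>\<close> because 1 belongs to the spectrum.
\<close>

lemma resolvent_bound:
  fixes r \<theta> :: real
  assumes r: "t < r" and \<theta>: "0 < \<theta>" and z: "z \<notin> spectral_nbhd M V r \<theta> T"
  defines "H \<equiv> SUP z\<in>- spectral_nbhd M V r \<theta> T. opnorm1 M V (resolvent M V T z)"
  assumes f: "f \<in> wball M V E"
  shows "resolvent_series z f \<in> wball M V (H * E)"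
proof -
  obtain D where D: "0 \<le> D" "\<And>f E. f \<in> wball M V E \<Longrightarrow> proj f \<in> wball M V (E * D)"
    using proj_wball by blast
  have C: "0 \<le> C"
  proof -
    have "0 \<le> C * t ^ 0 * 1"
      using wball_nonneg[OF rateD[OF rate wball_weight_V[OF indicator_in_wball weight_1], of 0] weight_V] .
    then show ?thesis by simp
  qed
  have outside: "t < cmod w" "w \<noteq> 1" "r < cmod w" "\<theta> < cmod (w - 1)"
    if w: "w \<notin> spectral_nbhd M V r \<theta> T" for w
  proof -
    show "r < cmod w" using w by (simp add: spectral_nbhd_def)
    then show "t < cmod w" using r by simp
    have "infdist w (spectrum M V T) \<le> dist w 1" by (rule infdist_le[OF one_in_spectrum])
    then show "\<theta> < cmod (w - 1)" using w by (simp add: spectral_nbhd_def dist_norm)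
    then show "w \<noteq> 1" using \<theta> by auto
  qed
  have bounded: "resolvent M V T w g \<in> wball M V (C / (r - t) + D / \<theta>)"
    if w: "w \<notin> spectral_nbhd M V r \<theta> T" and g: "g \<in> wball M V 1" for w g
  proof -
    note w' = outside[OF w]
    have "resolvent_series w g \<in> wball M V ((C / (cmod w - t) + D / cmod (w - 1)) * 1)"
      by (rule resolvent_series_wball[OF D g w'(1)])
    then have "resolvent_series w g \<in> wball M V (C / (r - t) + D / \<theta>)"
      by (rule wball_increase) (use w' C D r \<theta> in \<open>auto intro!: add_mono divide_left_mono mult_pos_pos\<close>)
    then show ?thesis using resolvent_eq[OF wball_V_in_wspace[OF g] w'(1,2)] by simp
  qed
  have "opnorm1 M V (resolvent M V T z) \<le> H"
    unfolding H_def
    by (rule cSUP_upper[OF _ bdd_aboveI2[where M = "C / (r - t) + D / \<theta>"]])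
      (use z bounded in \<open>auto intro!: opnorm_le\<close>)
  moreover have "resolvent M V T z f \<in> wball M V (opnorm1 M V (resolvent M V T z) * E)"
  proof (rule opnorm_wball[OF weight_V weight_V bounded[OF z] _ f])
    show "resolvent M V T z (\<lambda>x. a * g x) = (\<lambda>x. a * resolvent M V T z g x)" if "g \<in> wspace M V" for a g
      using outside[OF z] that by (simp add: resolvent_eq resolvent_series_scale wspace_scale)
  qed
  ultimately show "resolvent_series z f \<in> wball M V (H * E)"
    using resolvent_eq[OF wball_V_in_wspace[OF f] outside(1,2)[OF z]] wball_nonneg[OF f]
    by (metis mult_right_mono wball_increase weight_V)
qed

text \<open>
  On the eigenfunction \<open>\<Phi>\<close> the resolvent is multiplication by \<open>1 / (z - 1)\<close>, which has modulus at least 1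
  at any real point between \<open>r\<close> and \<open>1 - \<theta>\<close>.
\<close>

lemma resolvent_bound_lower:
  fixes r \<theta> :: real
  assumes r: "t + \<theta> < r" "r < 1 - \<theta>" and \<theta>: "0 < \<theta>"
  defines "H \<equiv> SUP z\<in>- spectral_nbhd M V r \<theta> T. opnorm1 M V (resolvent M V T z)"
  shows "1 \<le> H"
proof -
  \<comment> \<open>A real point of the annulus, hence off the spectral neighbourhood.\<close>
  define z where "z = complex_of_real ((r + (1 - \<theta>)) / 2)"
  have norm_z: "cmod z = (r + (1 - \<theta>)) / 2"
    using r \<theta> t unfolding z_def norm_of_real by simp
  have z: "z \<notin> spectral_nbhd M V r \<theta> T" "t < cmod z" "z \<noteq> 1"
  proof -
    show "z \<notin> spectral_nbhd M V r \<theta> T"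
      using r by (intro not_in_spectral_nbhd[OF _ _ r(1)]) (simp_all add: norm_z)
    show "t < cmod z" "z \<noteq> 1" using r \<theta> norm_z by auto
  qed
  have dist_1: "cmod (z - 1) \<le> 1"
  proof -
    have "z - 1 = complex_of_real ((r + (1 - \<theta>)) / 2 - 1)" by (simp add: z_def)
    then have "cmod (z - 1) = \<bar>(r + (1 - \<theta>)) / 2 - 1\<bar>" by (simp only: norm_of_real)
    then show ?thesis using r \<theta> t by (simp add: abs_if)
  qed
  define b where "b = wnorm M V \<Phi>"
  have b: "\<Phi> \<in> wball M V b" unfolding b_def by (rule wspace_wball_wnorm[OF weight_V Phi_wspace])
  have "resolvent_series z (\<lambda>x. (z - 1) * \<Phi> x) = \<Phi>"
    using resolvent_series_left_inverse[OF Phi_wspace z(2,3)] by (simp add: T_Phi left_diff_distrib)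
  moreover have "resolvent_series z (\<lambda>x. (z - 1) * \<Phi> x) \<in> wball M V (H * (cmod (z - 1) * b))"
    unfolding H_def by (rule resolvent_bound[OF _ \<theta> z(1) wball_scale[OF b]]) (use r \<theta> in simp)
  ultimately have "b \<le> H * cmod (z - 1) * b"
    using wnorm_le_iff[OF weight_V Phi_wspace] by (simp add: b_def mult.assoc)
  moreover have "0 < b"
  proof (rule ccontr)
    assume "\<not> 0 < b"
    then have "\<Phi> x = 0" for x
      using wballD(2)[OF wball_increase[OF b, of 0], of x] wballD(3)[OF b, of x] by (cases "x \<in> space M") auto
    then show False using integral_Phi by simp
  qed
  ultimately have "1 \<le> H * cmod (z - 1)" by simp
  then show ?thesis
    using dist_1 mult_left_mono[OF dist_1, of H] by (smt (verit) mult_nonpos_nonneg norm_ge_zero)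
qed

end

end

section \<open>Perturbation bound for functionals\<close>

lemma sum_inverse_power_le:
  fixes r :: real
  assumes r: "0 < r" "r < 1"
  shows "(\<Sum>j<n. 1 / r ^ Suc j) \<le> 1 / (r ^ n * (1 - r))"
proof -
  have "(\<Sum>j<n. 1 / r ^ Suc j) = (1 / r ^ n - 1) / (1 - r)"
  proof (induction n)
    case (Suc n)
    have "(\<Sum>j<Suc n. 1 / r ^ Suc j) = (1 / r ^ n - 1) / (1 - r) + 1 / r ^ Suc n"
      by (simp only: sum.lessThan_Suc Suc)
    also have "\<dots> = (1 / r ^ Suc n - 1) / (1 - r)" using r by (simp add: field_simps)
    finally show ?case .
  qed simp
  also have "\<dots> \<le> (1 / r ^ n) / (1 - r)" using r by (intro divide_right_mono) auto
  finally show ?thesis by simp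
qed

context weighted_space
begin

text \<open>
  The finite Neumann expansion of \<open>u\<close> in terms of \<open>z * u - K u\<close>, seen through \<open>m\<close>.
\<close>

lemma functional_telescope:
  assumes "bounded_functional M V m" "drift_kernel M V K \<delta> L"
    and u: "u \<in> wspace M V" and z: "z \<noteq> 0"
  shows "m u = (\<Sum>j<n. m ((kernel_op M K ^^ j) (\<lambda>x. z * u x - kernel_op M K u x)) / z ^ Suc j)
    + m ((kernel_op M K ^^ n) u) / z ^ n"
proof -
  interpret m: bounded_functional M V m by fact
  interpret K: drift_kernel M V K \<delta> L by fact
  have step: "m ((K.T ^^ j) (\<lambda>x. z * u x - K.T u x)) = z * m ((K.T ^^ j) u) - m ((K.T ^^ Suc j) u)" for j
  proof -
    have "(K.T ^^ j) (\<lambda>x. z * u x - K.T u x) = (\<lambda>x. z * (K.T ^^ j) u x - (K.T ^^ Suc j) u x)"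
      using K.iter_diff[OF wspace_scale[OF u] K.T_wspace[OF u]] by (simp add: K.iter_scale funpow_swap1)
    then show ?thesis
      by (simp only: m.m_diff m.m_scale wspace_scale K.iter_wspace[OF u])
  qed
  show ?thesis
  proof (induction n)
    case (Suc n)
    then show ?case using z by (simp add: step field_simps)
  qed simp
qed

text \<open>
  The Keller-Liverani estimate. Let \<open>s\<close> and \<open>w\<close> be the strong and weak norms of \<open>m\<close>. Expanding \<open>n1\<close> times
  along \<open>Q\<close> bounds \<open>s\<close> by half of \<open>s\<close>, a multiple of \<open>w\<close> and a multiple of the data \<open>\<kappa>\<close>. To bound \<open>w\<close>, write
  \<open>m\<close> as \<open>g \<circ> (z - P)\<^sup>-\<^sup>1\<close> with \<open>g = m \<circ> (z - P)\<close> and expand the resolvent \<open>n2\<close> times along \<open>P\<close>: the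
  strong norm of \<open>g\<close> enters only with the small factor \<open>(\<alpha> / r) ^ n2\<close>, and the weak norm of \<open>g\<close> is at most
  \<open>\<kappa> + \<Delta> * s\<close>. The choices of \<open>n2\<close> and \<open>\<epsilon>\<close> make each of the two resulting multiples of \<open>s\<close> at most
  \<open>s / 4\<close>, and the remaining \<open>s / 2\<close> is absorbed.
\<close>

lemma functional_perturbation_bound:
  fixes H B \<alpha> r \<Delta> \<kappa> \<epsilon> :: real and n1 n2 :: nat
  assumes m: "bounded_functional M V m"
    and P: "drift_kernel M V P \<delta> L" and Q: "drift_kernel M V Q \<delta> L"
    and r: "0 < r" "r < 1" and z: "r < cmod z" "cmod z < 1"
    and resolvent: "\<And>f. f \<in> wball M (\<lambda>_. 1) 1 \<Longrightarrow>
        \<exists>u. u \<in> wball M V H \<and> (\<lambda>x. z * u x - kernel_op M P u x) = f"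
    and close: "\<And>f. f \<in> wball M (\<lambda>_. 1) 1 \<Longrightarrow>
        (\<lambda>x. kernel_op M Q f x - kernel_op M P f x) \<in> wball M V \<Delta>"
    and B: "L / (1 - \<delta>) \<le> B" and \<alpha>: "\<delta> \<le> \<alpha>" and H: "0 \<le> H"
    and n1: "(\<alpha> / r) ^ n1 \<le> 1 / 2"
    and n2: "8 * B * (B + 3) * H * (\<alpha> / r) ^ n2 \<le> r ^ n1"
    and \<epsilon>: "\<epsilon> = r ^ (n1 + n2) / (8 * B * (H * B + inverse (1 - r)))" and \<Delta>: "\<Delta> \<le> \<epsilon>"
    and \<kappa>: "\<And>f C. f \<in> wball M V C \<Longrightarrow> cmod (m (\<lambda>x. z * f x - kernel_op M Q f x)) \<le> \<kappa> * C"
    and f: "f \<in> wball M V C"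
  shows "cmod (m f) \<le> (4 * (B + 1) / (r ^ n1 * (1 - r)) + 1 / (2 * \<epsilon>)) * \<kappa> * C"
proof -
  interpret m: bounded_functional M V m by fact
  interpret P: drift_kernel M V P \<delta> L by fact
  interpret Q: drift_kernel M V Q \<delta> L by fact
  define s where "s = m.fnorm V"
  define w where "w = m.fnorm (\<lambda>_. 1)"
  have sw: "0 \<le> s" "0 \<le> w" by (auto simp: s_def w_def m.fnorm_nonneg)
  have "0 < L / (1 - \<delta>)" using P.delta P.L_pos by simp
  then have B_pos: "0 < B" using B by linarith
  have "L \<le> L / (1 - \<delta>)" using P.delta P.L_pos by (simp add: field_simps)
  then have LB: "L \<le> B" using B by linarith
  have \<alpha>_pos: "0 < \<alpha>" using \<alpha> P.delta by linarith
  have z0: "z \<noteq> 0" using z r by auto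
  have one: "(\<lambda>x. if x \<in> space M then 1 else 0) \<in> wball M V 1"
    by (rule wball_weight_V[OF indicator_in_wball weight_1])
  have "0 \<le> \<kappa> * 1" by (rule order_trans[OF norm_ge_zero \<kappa>[OF one]])
  then have \<kappa>_nonneg: "0 \<le> \<kappa>" by simp
  have div_z: "cmod (a / z ^ j) \<le> b / r ^ j" if "cmod a \<le> b" for a b j
  proof -
    have "r ^ j \<le> cmod z ^ j" using z r by (intro power_mono) auto
    then have "cmod a / cmod z ^ j \<le> b / r ^ j"
      using that r order_trans[OF norm_ge_zero that] by (intro frac_le) auto
    then show ?thesis by (simp add: norm_divide norm_power)
  qed
  have telescoped: "cmod (k u) \<le> b / (r ^ n * (1 - r)) + b' / r ^ n"
    if k: "bounded_functional M V k" and K: "drift_kernel M V K \<delta> L" and u: "u \<in> wspace M V"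
      and b: "\<And>j. cmod (k ((kernel_op M K ^^ j) (\<lambda>x. z * u x - kernel_op M K u x))) \<le> b"
      and b': "cmod (k ((kernel_op M K ^^ n) u)) \<le> b'"
    for k K u b b' n
  proof -
    have b0: "0 \<le> b" using b[of 0] norm_ge_zero order_trans by blast
    have "cmod (k u) \<le> (\<Sum>j<n. b / r ^ Suc j) + b' / r ^ n"
      unfolding functional_telescope[OF k K u z0, of n]
      by (intro norm_triangle_mono sum_norm_le div_z b b')
    also have "(\<Sum>j<n. b / r ^ Suc j) = b * (\<Sum>j<n. 1 / r ^ Suc j)"
      by (simp add: sum_distrib_left)
    also have "\<dots> \<le> b * (1 / (r ^ n * (1 - r)))"
      using b0 sum_inverse_power_le[OF r] by (intro mult_left_mono)
    finally show ?thesis by simp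
  qed
  have DF: "cmod (k ((kernel_op M K ^^ n) u))
      \<le> C * (\<alpha> ^ n * bounded_functional.fnorm M k V + B * bounded_functional.fnorm M k (\<lambda>_. 1))"
    if k: "bounded_functional M V k" and K: "drift_kernel M V K \<delta> L" and u: "u \<in> wball M V C"
    for k K u C n
  proof -
    interpret k: bounded_functional M V k by fact
    have "cmod (k ((kernel_op M K ^^ n) u))
        \<le> C * (\<delta> ^ n * k.fnorm V + L / (1 - \<delta>) * k.fnorm (\<lambda>_. 1))"
      by (rule drift_kernel.Doeblin_Fortet[OF K k u])
    also have "\<dots> \<le> C * (\<alpha> ^ n * k.fnorm V + B * k.fnorm (\<lambda>_. 1))"
      using wball_nonneg[OF u] \<alpha> B P.delta
      by (intro mult_left_mono add_mono mult_right_mono power_mono k.fnorm_nonneg) auto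
    finally show ?thesis .
  qed
  \<comment> \<open>Expansion along \<open>Q\<close>; half of the strong norm is absorbed because of the choice of \<open>n1\<close>.\<close>
  have "s \<le> \<kappa> * (1 + B) / (r ^ n1 * (1 - r)) + (\<alpha> ^ n1 * s + B * w) / r ^ n1"
    unfolding s_def
  proof (rule m.fnorm_le[OF weight_V], fold s_def)
    fix g assume g: "g \<in> wball M V 1"
    note g' = wball_V_in_wspace[OF g]
    show "cmod (m g) \<le> \<kappa> * (1 + B) / (r ^ n1 * (1 - r)) + (\<alpha> ^ n1 * s + B * w) / r ^ n1"
    proof (rule telescoped[OF m Q g'])
      show "cmod (m ((Q.T ^^ n1) g)) \<le> \<alpha> ^ n1 * s + B * w"
        using DF[OF m Q g] by (simp add: s_def w_def)
      fix j
      have Qg: "(Q.T ^^ j) g \<in> wball M V (1 + B)"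
        by (rule wball_increase[OF Q.iter_wball_V[OF g]]) (use B in auto)
      have "(Q.T ^^ j) (\<lambda>x. z * g x - Q.T g x) = (\<lambda>x. z * (Q.T ^^ j) g x - Q.T ((Q.T ^^ j) g) x)"
        using Q.iter_diff[OF wspace_scale[OF g'] Q.T_wspace[OF g']] by (simp add: Q.iter_scale funpow_swap1)
      then show "cmod (m ((Q.T ^^ j) (\<lambda>x. z * g x - Q.T g x))) \<le> \<kappa> * (1 + B)"
        using \<kappa>[OF Qg] by simp
    qed
  qed
  also have "\<dots> = \<kappa> * (1 + B) / (r ^ n1 * (1 - r)) + ((\<alpha> / r) ^ n1 * s + B * w / r ^ n1)"
    by (simp add: add_divide_distrib power_divide)
  also have "\<dots> \<le> \<kappa> * (1 + B) / (r ^ n1 * (1 - r)) + (1 / 2 * s + B * w / r ^ n1)"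
    using n1 sw by (intro add_mono mult_right_mono) auto
  finally have strong: "s \<le> 2 * (\<kappa> * (1 + B) / (r ^ n1 * (1 - r))) + 2 * (B * w / r ^ n1)"
    by linarith
  \<comment> \<open>A crude bound for the strong norm of \<open>g\<close> suffices: \<open>B + 3\<close> exceeds \<open>\<bar>z\<bar>\<close> plus the norm
     \<open>\<delta> + L\<close> of \<open>P\<close>.\<close>
  define g where "g = (\<lambda>f. m (\<lambda>x. z * f x - P.T f x))"
  have g_eq: "g f = z * m f - m (P.T f)" if "f \<in> wspace M V" for f
    using that by (simp add: g_def m.m_diff m.m_scale wspace_scale P.T_wspace)
  have g_bound: "cmod (g f) \<le> (B + 3) * s" if f: "f \<in> wball M V 1" for f
  proof -
    have "cmod (g f) \<le> cmod z * cmod (m f) + cmod (m (P.T f))"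
      unfolding g_eq[OF wball_V_in_wspace[OF f]]
      by (rule order_trans[OF norm_triangle_ineq4]) (simp add: norm_mult)
    also have "\<dots> \<le> 1 * (s * 1) + s * (1 * (\<delta> + L))"
      using z m.fnorm_bound[OF weight_V f] m.fnorm_bound[OF weight_V P.T_wball_V[OF f]] sw
      by (intro add_mono mult_mono) (auto simp: s_def)
    also have "\<dots> = (1 + \<delta> + L) * s" by (simp add: algebra_simps)
    also have "\<dots> \<le> (B + 3) * s"
      using sw P.delta LB by (intro mult_right_mono) auto
    finally show ?thesis .
  qed
  have g_functional: "bounded_functional M V g"
  proof (unfold_locales)
    show "g (\<lambda>x. f x + h x) = g f + g h" if "f \<in> wspace M V" "h \<in> wspace M V" for f h
      using that by (simp add: g_eq wspace_add P.T_add m.m_add P.T_wspace algebra_simps)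
    show "g (\<lambda>x. a * f x) = a * g f" if "f \<in> wspace M V" for a f
      using that by (simp add: g_eq wspace_scale P.T_scale m.m_scale P.T_wspace algebra_simps)
    show "\<exists>C. \<forall>f\<in>wball M V 1. cmod (g f) \<le> C" using g_bound by blast
  qed
  interpret g: bounded_functional M V g by (rule g_functional)
  define gs where "gs = g.fnorm V"
  define gw where "gw = g.fnorm (\<lambda>_. 1)"
  have gsw: "0 \<le> gs" "0 \<le> gw" by (auto simp: gs_def gw_def g.fnorm_nonneg)
  have gs: "gs \<le> (B + 3) * s" unfolding gs_def by (rule g.fnorm_le[OF weight_V g_bound])
  have gw: "gw \<le> \<kappa> + s * \<Delta>"
    unfolding gw_def
  proof (rule g.fnorm_le[OF weight_1])
    fix f assume f: "f \<in> wball M (\<lambda>_. 1) 1"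
    note fV = wball_1_in_wspace[OF f]
    have "g f = m (\<lambda>x. z * f x - Q.T f x) + m (\<lambda>x. Q.T f x - P.T f x)"
      using fV by (simp add: g_eq m.m_diff m.m_scale wspace_scale P.T_wspace Q.T_wspace)
    also have "cmod \<dots> \<le> \<kappa> * 1 + m.fnorm V * \<Delta>"
      using \<kappa>[OF wball_weight_V[OF f weight_1]] m.fnorm_bound[OF weight_V close[OF f]]
      by (intro norm_triangle_mono)
    finally show "cmod (g f) \<le> \<kappa> + s * \<Delta>" by (simp add: s_def)
  qed
  \<comment> \<open>Expansion of the resolvent of \<open>P\<close>; the weak norm of \<open>m\<close> only sees it on bounded functions, which the
     powers of \<open>P\<close> preserve.\<close>
  define E where "E = (H * B + inverse (1 - r)) / r ^ n2"
  have E: "0 < E" using H B_pos r by (auto simp: E_def intro!: add_nonneg_pos divide_pos_pos)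
  have "w \<le> gw / (r ^ n2 * (1 - r)) + H * (\<alpha> ^ n2 * gs + B * gw) / r ^ n2"
    unfolding w_def
  proof (rule m.fnorm_le[OF weight_1])
    fix f assume f: "f \<in> wball M (\<lambda>_. 1) 1"
    obtain u where u: "u \<in> wball M V H" "(\<lambda>x. z * u x - P.T u x) = f" using resolvent[OF f] by blast
    have "cmod (g u) \<le> gw / (r ^ n2 * (1 - r)) + H * (\<alpha> ^ n2 * gs + B * gw) / r ^ n2"
    proof (rule telescoped[OF g_functional P wball_V_in_wspace[OF u(1)]])
      show "cmod (g ((P.T ^^ n2) u)) \<le> H * (\<alpha> ^ n2 * gs + B * gw)"
        unfolding gs_def gw_def by (rule DF[OF g_functional P u(1)])
      show "cmod (g ((P.T ^^ j) (\<lambda>x. z * u x - P.T u x))) \<le> gw" for j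
        unfolding u(2) gw_def using g.fnorm_bound[OF weight_1 P.iter_wball_1[OF f]] by simp
    qed
    moreover have "g u = m f" by (simp add: g_def u(2))
    ultimately show "cmod (m f) \<le> gw / (r ^ n2 * (1 - r)) + H * (\<alpha> ^ n2 * gs + B * gw) / r ^ n2"
      by simp
  qed
  also have "\<dots> = H * (\<alpha> / r) ^ n2 * gs + E * gw"
    using r by (simp add: E_def power_divide field_simps)
  also have "\<dots> \<le> H * (\<alpha> / r) ^ n2 * ((B + 3) * s) + E * (\<kappa> + s * \<Delta>)"
    using gs gw E H \<alpha>_pos r by (intro add_mono mult_left_mono) auto
  finally have w_le: "w \<le> H * (\<alpha> / r) ^ n2 * ((B + 3) * s) + E * (\<kappa> + s * \<Delta>)" .
  have \<epsilon>_pos: "0 < \<epsilon>"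
    unfolding \<epsilon> using H B_pos r by (intro divide_pos_pos mult_pos_pos add_nonneg_pos) auto
  have \<epsilon>_eq: "2 * B * E / r ^ n1 = 1 / (4 * \<epsilon>)"
    using r B_pos by (simp add: \<epsilon> E_def power_add field_simps)
  have "2 * (B * w / r ^ n1)
      \<le> 2 * (B * (H * (\<alpha> / r) ^ n2 * ((B + 3) * s) + E * (\<kappa> + s * \<Delta>)) / r ^ n1)"
    using w_le B_pos r by (intro mult_left_mono divide_right_mono) auto
  also have "\<dots> = (8 * B * (B + 3) * H * (\<alpha> / r) ^ n2) / r ^ n1 * (s / 4) + 2 * B * E / r ^ n1 * (\<kappa> + s * \<Delta>)"
    using r by (simp add: field_simps)
  also have "\<dots> \<le> 1 * (s / 4) + 1 / (4 * \<epsilon>) * (\<kappa> + s * \<epsilon>)"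
    unfolding \<epsilon>_eq using n2 r sw \<Delta> \<epsilon>_pos
    by (intro add_mono mult_mono mult_left_mono order_refl) (auto simp: divide_le_eq)
  also have "\<dots> = s / 2 + \<kappa> / (4 * \<epsilon>)" using \<epsilon>_pos by (simp add: field_simps)
  finally have "s \<le> (4 * (B + 1) / (r ^ n1 * (1 - r)) + 1 / (2 * \<epsilon>)) * \<kappa>"
    using strong by (simp add: algebra_simps add_divide_distrib)
  then have "s * C \<le> (4 * (B + 1) / (r ^ n1 * (1 - r)) + 1 / (2 * \<epsilon>)) * \<kappa> * C"
    using wball_nonneg[OF f] by (intro mult_right_mono) auto
  with m.fnorm_bound[OF weight_V f] show ?thesis by (simp add: s_def)
qed

end

section \<open>From resolvent bounds to a uniform rate of convergence\<close>

lemma power_bound_right_limit: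
  fixes a b t hi :: real
  assumes "t < hi" "\<And>s. t < s \<Longrightarrow> s < hi \<Longrightarrow> a \<le> b * s ^ k"
  shows "a \<le> b * t ^ k"
proof (rule tendsto_lowerbound)
  show "((\<lambda>s. b * s ^ k) \<longlongrightarrow> b * t ^ k) (at_right t)" by (intro tendsto_intros)
  show "\<forall>\<^sub>F s in at_right t. a \<le> b * s ^ k"
    using assms by (auto simp: eventually_at_right)
qed simp

context spectral_kernel
begin

text \<open>
  In terms of the transposed operator: \<open>z - T\<close> is bounded below by \<open>1 / c\<close> on functionals. This makes
  sense before \<open>z - T\<close> is known to be invertible.
\<close>

definition dual_resolvent_bound :: "real \<Rightarrow> complex \<Rightarrow> bool" where
  "dual_resolvent_bound c z \<longleftrightarrow> (\<forall>m \<kappa>. bounded_functional M V m \<longrightarrow>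
     (\<forall>f D. f \<in> wball M V D \<longrightarrow> cmod (m (\<lambda>x. z * f x - T f x)) \<le> \<kappa> * D) \<longrightarrow>
     (\<forall>f D. f \<in> wball M V D \<longrightarrow> cmod (m f) \<le> c * \<kappa> * D))"

lemma dual_resolvent_boundD:
  assumes "dual_resolvent_bound c z" "bounded_functional M V m"
    and "\<And>f D. f \<in> wball M V D \<Longrightarrow> cmod (m (\<lambda>x. z * f x - T f x)) \<le> \<kappa> * D"
    and "f \<in> wball M V D"
  shows "cmod (m f) \<le> c * \<kappa> * D"
  using assms unfolding dual_resolvent_bound_def by blast

text \<open>
  With \<open>w = 1 / z\<close> the expression \<open>z * res z x f\<close> is the power series of the deviations plus
  \<open>proj f x / (1 - w)\<close>, and \<open>z\<^sup>2 * res_sq z x f\<close> is the analogous series with factors \<open>n + 1\<close> plus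
  \<open>proj f x / (1 - w)\<^sup>2\<close>. The dual bound applies to \<open>res z x\<close>, since composing it with \<open>z - T\<close> gives evaluation
  at \<open>x\<close>, of norm at most \<open>V x\<close>, and then to \<open>res_sq z x\<close>, since composing that with \<open>z - T\<close> gives \<open>res z x\<close>.
\<close>

lemma coefficient_bounds:
  assumes rate: "rate C t" and t: "0 < t" "t < s" and s: "s < 1"
    and inv: "\<And>z. cmod z = s \<Longrightarrow> dual_resolvent_bound c z"
    and f: "f \<in> wball M V D" and x: "x \<in> space M"
  shows "cmod (dev n f x) \<le> c * V x * D * s ^ (n + 1)"
    and "real (n + 1) * cmod (dev n f x) \<le> c\<^sup>2 * V x * D * s ^ (n + 2)"
proof -
  \<comment> \<open>The circle \<open>\<bar>z\<bar> = s\<close> becomes \<open>\<bar>w\<bar> = R > 1\<close>; the radius \<open>R'\<close> corresponds to the midpoint of \<open>t\<close> and \<open>s\<close>, where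
     the series still converges.\<close>
  define R where "R = 1 / s"
  define R' where "R' = 2 / (s + t)"
  have R: "0 < R" "R < R'" "1 < R" using s t by (auto simp: R_def R'_def field_simps)
  have q: "0 < t * R'" "t * R' < 1" using t by (auto simp: R'_def field_simps)
  define a where "a = (\<lambda>l. dev l f x)"
  define E where "E = C * D * V x"
  have a: "cmod (a l) \<le> E * t ^ l" for l
    using dev_bound[OF rate t(1) f x] by (simp add: a_def E_def)
  have E: "0 \<le> E" using order_trans[OF norm_ge_zero a[of 0]] by simp
  have weighted: "cmod (a l) * R' ^ l \<le> E * (t * R') ^ l" for l
    using mult_right_mono[OF a[of l], of "R' ^ l"] R by (simp add: power_mult_distrib mult.assoc)
  have summ: "summable (\<lambda>l. cmod (a l) * R' ^ l)"
    by (rule summable_comparison_test'[where g = "\<lambda>l. E * (t * R') ^ l" and N = 0])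
      (use q R weighted in \<open>auto intro!: summable_mult\<close>)
  have summ': "summable (\<lambda>l. cmod (of_nat (Suc l) * a l) * R' ^ l)"
  proof (rule summable_comparison_test'[where g = "\<lambda>l. E * (of_nat (Suc l) * (t * R') ^ l)" and N = 0])
    show "summable (\<lambda>l. E * (of_nat (Suc l) * (t * R') ^ l))"
      using q by (intro summable_mult sums_summable[OF geometric_deriv_sums]) auto
    show "norm (cmod (of_nat (Suc l) * a l) * R' ^ l) \<le> E * (of_nat (Suc l) * (t * R') ^ l)" for l
    proof -
      have "norm (cmod (of_nat (Suc l) * a l) * R' ^ l) = of_nat (Suc l) * (cmod (a l) * R' ^ l)"
        using R by (simp add: norm_mult del: of_nat_Suc)
      also have "\<dots> \<le> of_nat (Suc l) * (E * (t * R') ^ l)"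
        by (intro mult_left_mono weighted) auto
      finally show ?thesis by (simp only: mult_ac)
    qed
  qed
  have fV: "f \<in> wspace M V" using wball_V_in_wspace[OF f] .
  define p where "p = proj f x"
  have at: "cmod (inverse w) = s" "t < cmod (inverse w)" "w \<noteq> 0" "w \<noteq> 1" "inverse w \<noteq> 1"
    if "cmod w = R" for w
  proof -
    show 1: "cmod (inverse w) = s" using that by (simp add: norm_inverse R_def)
    show "t < cmod (inverse w)" using 1 t by simp
    show "w \<noteq> 0" "w \<noteq> 1" "inverse w \<noteq> 1" using that R by auto
  qed
  have res_bound: "cmod (res z x g) \<le> c * V x * G" if z: "cmod z = s" and g: "g \<in> wball M V G" for z g G
  proof (rule dual_resolvent_boundD[OF inv[OF z] _ _ g])
    show "bounded_functional M V (res z x)"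
      using res_functional(1)[OF rate t(1) x] z t by simp
    fix h F assume h: "h \<in> wball M V F"
    have "res z x (\<lambda>x. z * h x - T h x) = h x"
      using z s t by (intro res_shift(1)[OF rate t(1) wball_V_in_wspace[OF h]]) auto
    then show "cmod (res z x (\<lambda>x. z * h x - T h x)) \<le> V x * F"
      using wballD(2)[OF h x] by (simp add: mult.commute)
  qed
  have res_sq_bound: "cmod (res_sq z x g) \<le> c * (c * V x) * G" if z: "cmod z = s" and g: "g \<in> wball M V G" for z g G
  proof (rule dual_resolvent_boundD[OF inv[OF z] _ _ g])
    show "bounded_functional M V (res_sq z x)"
      using res_functional(2)[OF rate t(1) x] z t by simp
    fix h F assume h: "h \<in> wball M V F"
    have "res_sq z x (\<lambda>x. z * h x - T h x) = res z x h"
      using z s t by (intro res_shift(2)[OF rate t(1) wball_V_in_wspace[OF h]]) auto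
    then show "cmod (res_sq z x (\<lambda>x. z * h x - T h x)) \<le> c * V x * F"
      using res_bound[OF z h] by simp
  qed
  note geometric = contour_integral_inverse_power_times_geometric[OF R(3), THEN has_contour_integral_lmul, where c = p]
  have "cmod (a n) \<le> s * (c * V x * D) / R ^ n"
  proof (rule power_series_coefficient_bound[OF R(1,2) summ, where g = "\<lambda>w. p / (1 - w)"])
    show "((\<lambda>w. p / (1 - w) / w ^ Suc n) has_contour_integral 0) (circlepath 0 R)"
      using geometric(1)[of n] by (simp add: mult.commute)
    fix w assume w: "cmod w = R"
    note w' = at[OF w]
    have summand: "a l * w ^ l = inverse w * (dev l f x / inverse w ^ Suc l)" for l
      using w'(3) by (simp add: a_def field_simps)
    have "(\<Sum>l. a l * w ^ l) = inverse w * (\<Sum>l. dev l f x / inverse w ^ Suc l)"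
      unfolding summand by (rule suminf_mult[OF summable_res(1)[OF rate t(1) fV w'(2)]])
    moreover have "p / (1 - w) = inverse w * (p / (inverse w - 1))"
      using w' by (simp add: field_simps)
    ultimately have "(\<Sum>l. a l * w ^ l) + p / (1 - w) = inverse w * res (inverse w) x f"
      by (simp add: res_def p_def distrib_left)
    then show "cmod ((\<Sum>l. a l * w ^ l) + p / (1 - w)) \<le> s * (c * V x * D)"
      using res_bound[OF w'(1) f] w'(1) t by (simp add: norm_mult)
  qed
  then show "cmod (dev n f x) \<le> c * V x * D * s ^ (n + 1)"
    by (simp add: a_def R_def power_divide mult_ac)
  have "cmod (of_nat (Suc n) * a n) \<le> s\<^sup>2 * (c * (c * V x) * D) / R ^ n"
  proof (rule power_series_coefficient_bound[OF R(1,2) summ', where g = "\<lambda>w. p / (1 - w)\<^sup>2"])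
    show "((\<lambda>w. p / (1 - w)\<^sup>2 / w ^ Suc n) has_contour_integral 0) (circlepath 0 R)"
      using geometric(2)[of n] by (simp add: mult.commute)
    fix w assume w: "cmod w = R"
    note w' = at[OF w]
    have summand: "of_nat (Suc l) * a l * w ^ l
        = (inverse w)\<^sup>2 * (of_nat (Suc l) * dev l f x / inverse w ^ Suc (Suc l))" for l
      using w'(3) by (simp add: a_def power2_eq_square field_simps)
    have "(\<Sum>l. of_nat (Suc l) * a l * w ^ l)
        = (inverse w)\<^sup>2 * (\<Sum>l. of_nat (Suc l) * dev l f x / inverse w ^ Suc (Suc l))"
      unfolding summand by (rule suminf_mult[OF summable_res(2)[OF rate t(1) fV w'(2)]])
    moreover have "p / (1 - w)\<^sup>2 = (inverse w)\<^sup>2 * (p / (inverse w - 1)\<^sup>2)"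
    proof -
      have "(1 - w)\<^sup>2 = w\<^sup>2 * (inverse w - 1)\<^sup>2"
        using w'(3) by (simp add: power_mult_distrib[symmetric] right_diff_distrib)
      then show ?thesis using w'(3) by (simp add: field_simps)
    qed
    ultimately have "(\<Sum>l. of_nat (Suc l) * a l * w ^ l) + p / (1 - w)\<^sup>2 = (inverse w)\<^sup>2 * res_sq (inverse w) x f"
      by (simp only: res_sq_def p_def distrib_left)
    then have "cmod ((\<Sum>l. of_nat (Suc l) * a l * w ^ l) + p / (1 - w)\<^sup>2) = s\<^sup>2 * cmod (res_sq (inverse w) x f)"
      using w'(1) by (simp only: norm_mult norm_power)
    also have "\<dots> \<le> s\<^sup>2 * (c * (c * V x) * D)"
      using res_sq_bound[OF w'(1) f] by (intro mult_left_mono) auto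
    finally show "cmod ((\<Sum>l. of_nat (Suc l) * a l * w ^ l) + p / (1 - w)\<^sup>2) \<le> s\<^sup>2 * (c * (c * V x) * D)" .
  qed
  then show "real (n + 1) * cmod (dev n f x) \<le> c\<^sup>2 * V x * D * s ^ (n + 2)"
    by (simp add: a_def R_def power_divide power2_eq_square norm_mult mult_ac del: of_nat_Suc)
qed

text \<open>
  Submultiplicativity: halving \<open>t ^ p\<close> at one time \<open>p\<close> improves the exponential rate by the factor
  \<open>q = (1 / 2) ^ (1 / p)\<close>. The factor \<open>2\<close> in the constant pays for an incomplete block of length less
  than \<open>p\<close>.
\<close>

lemma rate_from_half_step:
  assumes rate: "rate C t" "0 \<le> C" and t: "0 < t" and q: "0 < q" "q \<le> 1" "q ^ p = 1 / 2"
    and half: "\<And>f D. f \<in> wball M V D \<Longrightarrow> dev p f \<in> wball M V (t ^ p / 2 * D)"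
  shows "rate (2 * C\<^sup>2) (q * t)"
proof -
  have p: "0 < p" using q by (cases p) auto
  have qt: "(q * t) ^ p = t ^ p / 2" by (simp add: power_mult_distrib q)
  have multiple: "dev (j * p) f \<in> wball M V (C * (q * t) ^ (j * p) * D)" if f: "f \<in> wball M V D" for j f D
  proof (induction j)
    case 0
    then show ?case using rateD[OF rate(1) f, of 0] by simp
  next
    case (Suc j)
    have "dev p (dev (j * p) f) \<in> wball M V (t ^ p / 2 * (C * (q * t) ^ (j * p) * D))"
      by (rule half[OF Suc])
    then show ?case
      by (simp add: dev_dev[OF wball_V_in_wspace[OF f]] qt[symmetric] power_add mult_ac)
  qed
  have "dev n f \<in> wball M V (2 * C\<^sup>2 * (q * t) ^ n * D)" if f: "f \<in> wball M V D" for n f D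
  proof -
    define i where "i = n mod p"
    have n: "n = n div p * p + i" and i: "i < p" using p by (auto simp: i_def)
    have "dev (n div p * p) (dev i f) \<in> wball M V (C * (q * t) ^ (n div p * p) * (C * t ^ i * D))"
      by (intro multiple rateD[OF rate(1) f])
    then have "dev n f \<in> wball M V (C * (q * t) ^ (n div p * p) * (C * t ^ i * D))"
      using n by (simp add: dev_dev[OF wball_V_in_wspace[OF f]])
    moreover have "1 \<le> 2 * q ^ i"
      using power_decreasing[of i p q] i q by simp
    then have "t ^ i \<le> 2 * (q * t) ^ i"
      using t mult_right_mono[of 1 "2 * q ^ i" "t ^ i"] by (simp add: power_mult_distrib mult.assoc)
    then have "C * (q * t) ^ (n div p * p) * (C * t ^ i * D)
        \<le> C * (q * t) ^ (n div p * p) * (C * (2 * (q * t) ^ i) * D)"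
      using rate(2) q t wball_nonneg[OF f] by (intro mult_left_mono mult_right_mono) auto
    moreover have "C * (q * t) ^ (n div p * p) * (C * (2 * (q * t) ^ i) * D) = 2 * C\<^sup>2 * (q * t) ^ n * D"
      by (subst (2) n) (simp add: power_add power2_eq_square)
    ultimately show ?thesis using wball_increase[OF _ _ weight_V] by metis
  qed
  then show ?thesis by (simp add: rate_def)
qed

lemma rate_mono:
  assumes "rate C t" "0 \<le> C" "0 \<le> t" "t \<le> t'" shows "rate C t'"
proof -
  have "dev n f \<in> wball M V (C * t' ^ n * D)" if f: "f \<in> wball M V D" for n f D
    by (rule wball_increase[OF rateD[OF assms(1) f]])
      (use assms wball_nonneg[OF f] in \<open>auto intro!: mult_right_mono mult_left_mono power_mono\<close>)
  then show ?thesis by (simp add: rate_def)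
qed

text \<open>
  A resolvent bound that is uniform on an annulus lets any known rate in the annulus be improved by a fixed
  factor, so every rate above \<open>r\<close> is reached after finitely many steps. This replaces the
  analytic continuation of the resolvent across the annulus. The
  constant \<open>C\<^sub>0\<close> of the initial rate is forgotten, because the first coefficient bound involves \<open>c\<close> only.
\<close>

lemma uniform_rate:
  assumes start: "rate C\<^sub>0 t\<^sub>0" "0 \<le> C\<^sub>0" "0 < t\<^sub>0" "t\<^sub>0 < hi"
    and r: "0 < r" "r < hi" "hi \<le> 1"
    and inv: "\<And>z. r < cmod z \<Longrightarrow> cmod z < hi \<Longrightarrow> dual_resolvent_bound c z"
    and f: "f \<in> wball M V D"
  shows "dev n f \<in> wball M V (c * r ^ (n + 1) * D)"
proof -
  \<comment> \<open>At time \<open>p\<close> the factor \<open>n + 1\<close> in the bound for the squared resolvent outweighs \<open>2 * c\<^sup>2\<close>.\<close>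
  obtain p :: nat where p: "2 * c\<^sup>2 \<le> real p" "0 < p"
    by (metis real_arch_simple of_nat_0_less_iff gr0I order_trans of_nat_0 zero_le_power2 mult_nonneg_nonneg
        zero_le_numeral lessI less_imp_le_nat of_nat_le_iff)
  define q where "q = root p (1 / 2)"
  have q: "0 < q" "q < 1" "q ^ p = 1 / 2"
    using p(2) by (auto simp: q_def real_root_gt_0_iff)
  have improve: "\<exists>C'\<ge>0. rate C' (q * t)" if C: "rate C t" "0 \<le> C" and t: "r < t" "t < hi" for C t
  proof (intro exI conjI)
    show "rate (2 * C\<^sup>2) (q * t)"
    proof (rule rate_from_half_step[OF C _ q(1) less_imp_le[OF q(2)] q(3)])
      show "0 < t" using r t by simp
      fix f D assume f: "f \<in> wball M V D"
      note fV = dev_wspace[OF wball_V_in_wspace[OF f], of p]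
      show "dev p f \<in> wball M V (t ^ p / 2 * D)"
      proof (rule wballI)
        show "dev p f \<in> borel_measurable M" "\<And>x. x \<notin> space M \<Longrightarrow> dev p f x = 0"
          using fV by (auto simp: wspace_def)
        fix x assume x: "x \<in> space M"
        have "real (p + 1) * cmod (dev p f x) \<le> c\<^sup>2 * V x * D * t ^ (p + 2)"
          by (rule power_bound_right_limit[OF t(2)], rule coefficient_bounds(2)[OF C(1)])
            (use r t f x inv in auto)
        also have "\<dots> \<le> c\<^sup>2 * V x * D * t ^ p"
          using r t V_nonneg[OF x] wball_nonneg[OF f]
          by (intro mult_left_mono power_decreasing) auto
        also have "\<dots> \<le> (real (p + 1) / 2) * V x * D * t ^ p"
          using p r t V_nonneg[OF x] wball_nonneg[OF f] by (intro mult_right_mono) auto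
        also have "\<dots> = real (p + 1) * (t ^ p / 2 * D * V x)" by simp
        finally show "cmod (dev p f x) \<le> t ^ p / 2 * D * V x"
          by (rule mult_left_le_imp_le) simp
      qed
    qed
  qed simp
  have reach: "\<exists>C\<ge>0. rate C s" if s: "r < s" "s < hi" for s
  proof -
    have "\<exists>C\<ge>0. rate C (max s (q ^ j * t\<^sub>0))" for j
    proof (induction j)
      case 0
      then show ?case using rate_mono[OF start(1,2)] start by (intro exI[of _ C\<^sub>0]) auto
    next
      case (Suc j)
      then obtain C where C: "rate C (max s (q ^ j * t\<^sub>0))" "0 \<le> C" by blast
      have "q ^ j * t\<^sub>0 \<le> 1 * t\<^sub>0" using q start by (intro mult_right_mono power_le_one) auto
      then have "q ^ j * t\<^sub>0 < hi" using start by linarith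
      then have "max s (q ^ j * t\<^sub>0) < hi" using s by simp
      moreover have "r < max s (q ^ j * t\<^sub>0)" using s by simp
      ultimately obtain C' where C': "0 \<le> C'" "rate C' (q * max s (q ^ j * t\<^sub>0))"
        using improve[OF C] by blast
      have "q * max s (q ^ j * t\<^sub>0) \<le> max s (q ^ Suc j * t\<^sub>0)"
      proof (cases "s \<le> q ^ j * t\<^sub>0")
        case True
        then show ?thesis by (simp add: max_def mult.assoc)
      next
        case False
        then have "q * max s (q ^ j * t\<^sub>0) \<le> 1 * s" using q r s by (intro mult_mono) auto
        then show ?thesis by simp
      qed
      then show ?case using rate_mono[OF C'(2,1)] C'(1) q r s by (meson less_imp_le less_trans max.strict_coboundedI1 mult_pos_pos)
    qed
    moreover obtain j where "q ^ j < s / t\<^sub>0"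
      using real_arch_pow_inv[of "s / t\<^sub>0" q] q r s start by auto
    then have "max s (q ^ j * t\<^sub>0) = s" using start by (simp add: field_simps)
    ultimately show ?thesis by metis
  qed
  note fV = dev_wspace[OF wball_V_in_wspace[OF f], of n]
  show ?thesis
  proof (rule wballI)
    show "dev n f \<in> borel_measurable M" "\<And>x. x \<notin> space M \<Longrightarrow> dev n f x = 0"
      using fV by (auto simp: wspace_def)
    fix x assume x: "x \<in> space M"
    have "cmod (dev n f x) \<le> c * V x * D * r ^ (n + 1)"
    proof (rule power_bound_right_limit[OF r(2)])
      fix s assume s: "r < s" "s < hi"
      obtain C where "0 \<le> C" "rate C ((r + s) / 2)" using reach[of "(r + s) / 2"] s by auto
      then show "cmod (dev n f x) \<le> c * V x * D * s ^ (n + 1)"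
        using r s f x inv by (intro coefficient_bounds(1)[of C "(r + s) / 2"]) auto
    qed
    then show "cmod (dev n f x) \<le> c * r ^ (n + 1) * D * V x" by (simp add: mult_ac)
  qed
qed

end

section \<open>Comparison of the invariant measures\<close>

text \<open>
  Integrate \<open>Q ^ n f\<close> against \<open>\<mu>\<close>. Each of the \<open>n\<close> steps back to \<open>\<mu>(f)\<close> replaces one \<open>Q\<close> by \<open>P\<close>, under which \<open>\<mu>\<close>
  is invariant, at cost \<open>\<Delta> * \<mu>(V)\<close> because \<open>Q ^ j f\<close> remains bounded by 1. On the other hand
  \<open>Q ^ n f\<close> is \<open>\<nu>(f) * \<phi>\<close> up to \<open>e * V\<close>.
\<close>

lemma invariant_integral_perturbation:
  assumes P: "invariant_kernel M V P \<delta> L \<mu>" and prob: "prob_space \<mu>"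
    and Q: "spectral_kernel M V Q \<delta> L \<nu> \<phi>"
    and close: "\<And>f. f \<in> wball M (\<lambda>_. 1) 1 \<Longrightarrow>
        (\<lambda>x. kernel_op M Q f x - kernel_op M P f x) \<in> wball M V \<Delta>"
    and decay: "\<And>f. f \<in> wball M V 1 \<Longrightarrow> spectral_kernel.dev M Q \<nu> \<phi> n f \<in> wball M V e"
    and f: "f \<in> wball M (\<lambda>_. 1) 1"
  shows "cmod ((LINT x|\<nu>. f x) - (LINT x|\<mu>. f x))
    \<le> measure \<nu> (space M) * \<bar>1 - (LINT x|\<mu>. \<phi> x)\<bar> + L / (1 - \<delta>) * (e + real n * \<Delta>)"
proof -
  interpret P: invariant_kernel M V P \<delta> L \<mu> by fact
  interpret Q: spectral_kernel M V Q \<delta> L \<nu> \<phi> by fact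
  define v where "v = (LINT x|\<mu>. V x)"
  have v: "v \<le> L / (1 - \<delta>)"
    using P.integral_V_mu_le prob_space.prob_space[OF prob] P.space_mu by (simp add: v_def)
  have fV: "f \<in> wball M V 1" and fV': "f \<in> wspace M V"
    using P.wball_weight_V[OF f P.weight_1] P.wball_1_in_wspace[OF f] by auto
  define I where "I = (\<lambda>j. LINT x|\<mu>. (Q.T ^^ j) f x)"
  have step: "cmod (I (Suc j) - I j) \<le> \<Delta> * v" for j
  proof -
    define g where "g = (Q.T ^^ j) f"
    have g: "g \<in> wball M (\<lambda>_. 1) 1" unfolding g_def by (rule Q.iter_wball_1[OF f])
    note gV = P.wball_1_in_wspace[OF g]
    have "I (Suc j) - I j = (LINT x|\<mu>. Q.T g x) - (LINT x|\<mu>. P.T g x)"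
      by (simp add: I_def g_def P.integral_mu_T[OF gV, unfolded g_def])
    also have "\<dots> = (LINT x|\<mu>. Q.T g x - P.T g x)"
      by (rule Bochner_Integration.integral_diff[symmetric])
        (intro P.integrable_mu Q.T_wspace P.T_wspace gV)+
    also have "cmod \<dots> \<le> \<Delta> * v"
      unfolding v_def by (rule P.integral_mu_bound_V[OF close[OF g]])
    finally show ?thesis .
  qed
  have "I n - I 0 = (\<Sum>j<n. I (Suc j) - I j)" by (rule sum_lessThan_telescope[symmetric])
  also have "cmod \<dots> \<le> (\<Sum>j<n. \<Delta> * v)" by (intro sum_norm_le step)
  finally have telescoped: "cmod (I n - I 0) \<le> real n * (\<Delta> * v)" by simp
  have "I n = (LINT x|\<mu>. Q.dev n f x + (LINT y|\<nu>. f y) * Q.\<Phi> x)"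
    by (simp add: I_def Q.dev_def Q.proj_eq)
  also have "\<dots> = (LINT x|\<mu>. Q.dev n f x) + (LINT y|\<nu>. f y) * (LINT x|\<mu>. Q.\<Phi> x)"
    using P.integrable_mu[OF Q.dev_wspace[OF fV']] P.integrable_mu[OF Q.Phi_wspace] by simp
  also have "(LINT x|\<mu>. Q.\<Phi> x) = complex_of_real (LINT x|\<mu>. \<phi> x)"
  proof -
    have "(LINT x|\<mu>. Q.\<Phi> x) = (LINT x|\<mu>. complex_of_real (\<phi> x))"
      by (rule Bochner_Integration.integral_cong) (auto simp: Q.\<Phi>_def P.space_mu)
    then show ?thesis by simp
  qed
  finally have I_n: "I n = (LINT x|\<mu>. Q.dev n f x) + (LINT y|\<nu>. f y) * complex_of_real (LINT x|\<mu>. \<phi> x)" .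
  have remainder: "cmod (LINT x|\<mu>. Q.dev n f x) \<le> e * v"
    unfolding v_def by (rule P.integral_mu_bound_V[OF decay[OF fV]])
  have "(LINT x|\<nu>. f x) - (LINT x|\<mu>. f x)
      = (LINT x|\<nu>. f x) * complex_of_real (1 - (LINT x|\<mu>. \<phi> x)) + (I n - I 0) - (LINT x|\<mu>. Q.dev n f x)"
    unfolding I_n by (simp add: I_def algebra_simps)
  also have "cmod \<dots> \<le> cmod (LINT x|\<nu>. f x) * \<bar>1 - (LINT x|\<mu>. \<phi> x)\<bar>
      + real n * (\<Delta> * v) + e * v"
    by (intro order_trans[OF norm_triangle_ineq4] add_mono norm_triangle_mono telescoped remainder)
      (simp only: norm_mult norm_of_real order_refl)
  also have "\<dots> \<le> measure \<nu> (space M) * \<bar>1 - (LINT x|\<mu>. \<phi> x)\<bar> + real n * (\<Delta> * v) + e * v"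
    using Q.integral_mu_bound_1[OF f] by (intro add_right_mono mult_right_mono) auto
  also have "\<dots> = measure \<nu> (space M) * \<bar>1 - (LINT x|\<mu>. \<phi> x)\<bar> + v * (e + real n * \<Delta>)"
    by (simp add: algebra_simps)
  also have "\<dots> \<le> measure \<nu> (space M) * \<bar>1 - (LINT x|\<mu>. \<phi> x)\<bar> + L / (1 - \<delta>) * (e + real n * \<Delta>)"
    using v P.wball_nonneg[OF close[OF f]] P.wball_nonneg[OF decay[OF fV]]
    by (intro add_left_mono mult_right_mono) auto
  finally show ?thesis .
qed

text \<open>
  The time is the integer part of \<open>ln \<Delta> / ln r\<close>, for which \<open>r ^ (n + 1) \<le> \<Delta>\<close>. If \<open>\<Delta> = 0\<close> every \<open>n\<close> is
  allowed and the bound is a limit.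
\<close>

lemma bound_at_optimal_time:
  fixes r c v a X \<Delta> :: real
  assumes r: "0 < r" "r < 1" and \<Delta>: "0 \<le> \<Delta>" "\<Delta> < 1" and cv: "0 \<le> c" "0 \<le> v"
    and bound: "\<And>n. X \<le> a + v * (c * r ^ (n + 1) + real n * \<Delta>)"
  shows "X \<le> a + v * (c + \<bar>ln \<Delta>\<bar> / ln (inverse r)) * \<Delta>"
proof (cases "\<Delta> = 0")
  case True
  have "(\<lambda>n. a + v * (c * r ^ (n + 1) + real n * \<Delta>)) \<longlonglongrightarrow> a + v * (c * 0 + 0)"
    unfolding True using r by (intro tendsto_intros LIMSEQ_ignore_initial_segment LIMSEQ_power_zero) auto
  then have "X \<le> a + v * (c * 0 + 0)"
    by (rule tendsto_lowerbound) (use bound in auto)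
  then show ?thesis using True by simp
next
  case False
  then have D: "0 < \<Delta>" using \<Delta> by simp
  define y where "y = ln \<Delta> / ln r"
  have ln: "ln r < 0" "ln \<Delta> < 0" using r D \<Delta> by auto
  have y: "0 < y" using ln by (simp add: y_def divide_neg_neg)
  define n where "n = nat \<lfloor>y\<rfloor>"
  have n: "real n \<le> y" "y < real n + 1" using y by (auto simp: n_def)
  have "real (n + 1) * ln r \<le> ln \<Delta>"
    using n(2) ln by (simp add: y_def field_simps)
  then have "ln (r ^ (n + 1)) \<le> ln \<Delta>" using r by (simp only: ln_realpow)
  then have "r ^ (n + 1) \<le> \<Delta>" using r D by (simp only: ln_le_cancel_iff zero_less_power)
  moreover have "y = \<bar>ln \<Delta>\<bar> / ln (inverse r)" using r ln by (simp add: y_def ln_inverse)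
  ultimately have "v * (c * r ^ (n + 1) + real n * \<Delta>) \<le> v * (c * \<Delta> + \<bar>ln \<Delta>\<bar> / ln (inverse r) * \<Delta>)"
    using n(1) cv D by (intro mult_left_mono add_mono mult_right_mono) auto
  with bound[of n] show ?thesis by (simp add: algebra_simps)
qed

section \<open>The quantitative theorem\<close>

lemma floor_log_exponent:
  fixes X q :: real
  assumes X: "1 \<le> X" and q: "1 < q"
  defines "k \<equiv> \<lfloor>ln X / ln q\<rfloor> + 1"
  shows "int (nat k) = k" and "X \<le> q ^ nat k"
proof -
  have "0 \<le> ln X / ln q" using X q by simp
  then show k: "int (nat k) = k" by (simp add: k_def)
  have "ln X / ln q \<le> real_of_int k" by (simp add: k_def)
  also have "real_of_int k = real (nat k)" using k by (metis of_int_of_nat_eq)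
  finally have "ln X \<le> ln (q ^ nat k)" using q by (simp add: ln_realpow field_simps)
  then show "X \<le> q ^ nat k" using X q by (subst (asm) ln_le_cancel_iff) auto
qed

theorem theorem3p1:
  fixes M :: "'a measure"
    and V :: "'a \<Rightarrow> real" and x0 :: 'a
    and P :: "'a \<Rightarrow> 'a measure" and Phat :: "nat \<Rightarrow> 'a \<Rightarrow> 'a measure"
    and \<pi> :: "'a measure" and \<pi>hat :: "nat \<Rightarrow> 'a measure"
    and \<phi> :: "nat \<Rightarrow> 'a \<Rightarrow> real"
    and \<rho> \<delta> L r \<theta> :: real
    and k :: nat and \<rho>k :: real
  defines "\<Delta> \<equiv> \<lambda>j. opnorm01 M V (\<lambda>f x. kernel_op M (Phat j) f x - kernel_op M P f x)"
  defines "\<alpha> \<equiv> max (ess_spectral_radius M V (kernel_op M P)) \<delta>"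
  defines "B \<equiv> L / (1 - \<alpha>)"
  defines "A \<equiv> 1 + L / (1 - \<delta>)"
  defines "H \<equiv> (SUP z\<in>- spectral_nbhd M V r \<theta> (kernel_op M P).
                   opnorm1 M V (resolvent M V (kernel_op M P) z))"
  defines "n1 \<equiv> \<lfloor>ln 2 / ln (r / \<alpha>)\<rfloor> + 1"
  defines "n2 \<equiv> \<lfloor>ln (8 * B * (B + 3) * r powi (- n1) * H) / ln (r / \<alpha>)\<rfloor> + 1"
  defines "\<epsilon>1 \<equiv> r powi (n1 + n2) / (8 * B * (H * B + inverse (1 - r)))"
  defines "c \<equiv> 4 * (B + 1) / (r powi n1 * (1 - r)) + 1 / (2 * \<epsilon>1)"
  assumes V_meas: "V \<in> borel_measurable M"
    and V_ge_1: "\<And>x. x \<in> space M \<Longrightarrow> 1 \<le> V x"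
    and x0: "x0 \<in> space M" "V x0 = 1"
    and P_Markov: "P \<in> M \<rightarrow>\<^sub>M prob_algebra M"
    and Phat_sub_Markov: "\<And>j. 1 \<le> j \<Longrightarrow> Phat j \<in> M \<rightarrow>\<^sub>M subprob_algebra M"
    and PV_bounded: "\<exists>b. \<forall>x\<in>space M. (\<integral>\<^sup>+ y. ennreal (V y) \<partial>P x) \<le> ennreal (b * V x)"
    and PhatV_bounded:
      "\<And>j. 1 \<le> j \<Longrightarrow> \<exists>b. \<forall>x\<in>space M. (\<integral>\<^sup>+ y. ennreal (V y) \<partial>Phat j x) \<le> ennreal (b * V x)"
    and pi: "prob_space \<pi>" "invariant_measure M P \<pi>" "(\<integral>\<^sup>+ x. ennreal (V x) \<partial>\<pi>) < \<infinity>"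
    and pihat: "\<And>j. 1 \<le> j \<Longrightarrow> finite_measure (\<pi>hat j)"
      "\<And>j. 1 \<le> j \<Longrightarrow> invariant_measure M (Phat j) (\<pi>hat j)"
      "\<And>j. 1 \<le> j \<Longrightarrow> (\<integral>\<^sup>+ x. ennreal (V x) \<partial>\<pi>hat j) < \<infinity>"
    and phi_meas: "\<And>j. 1 \<le> j \<Longrightarrow> \<phi> j \<in> borel_measurable M"
    and phi_nonneg: "\<And>j x. 1 \<le> j \<Longrightarrow> x \<in> space M \<Longrightarrow> 0 \<le> \<phi> j x"
    and phi_bounded: "\<And>j. 1 \<le> j \<Longrightarrow> \<exists>b. \<forall>x\<in>space M. \<phi> j x \<le> b"
    and phi_invariant: "\<And>j x. 1 \<le> j \<Longrightarrow> x \<in> space M \<Longrightarrow> (LINT y|Phat j x. \<phi> j y) = \<phi> j x"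
    and phi_normalized: "\<And>j. 1 \<le> j \<Longrightarrow> (LINT x|\<pi>hat j. \<phi> j x) = 1"
    and Phat_finite_rank: "\<And>j. 1 \<le> j \<Longrightarrow> finite_rank_op M V (kernel_op M (Phat j))"
    and lim_pi_phi: "(\<lambda>j. LINT x|\<pi>. \<phi> j x) \<longlonglongrightarrow> 1"
    and lim_pihat_1: "(\<lambda>j. measure (\<pi>hat j) (space M)) \<longlonglongrightarrow> 1"
    and P_ergodic: "V_geom_ergodic M V P \<pi> (\<lambda>_. 1) \<rho>"
    and lim_Delta: "\<Delta> \<longlonglongrightarrow> 0"
    and delta: "0 < \<delta>" "\<delta> < 1" and L: "0 < L"
    and P_drift: "\<And>x. x \<in> space M \<Longrightarrow> (\<integral>\<^sup>+ y. ennreal (V y) \<partial>P x) \<le> ennreal (\<delta> * V x + L)"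
    and Phat_drift:
      "\<And>j x. 1 \<le> j \<Longrightarrow> x \<in> space M \<Longrightarrow> (\<integral>\<^sup>+ y. ennreal (V y) \<partial>Phat j x) \<le> ennreal (\<delta> * V x + L)"
    and r: "0 < r" "r < 1" and theta: "0 < \<theta>" "\<theta> < 1"
    and r_theta: "max \<alpha> \<rho> + \<theta> < r" "r < 1 - \<theta>"
    and k: "1 \<le> k" "\<Delta> k \<le> \<epsilon>1"
    and Phat_k_ergodic: "V_geom_ergodic M V (Phat k) (\<pi>hat k) (\<phi> k) \<rho>k" "\<rho>k < 1 - \<theta>"
  shows "(\<forall>n. opnorm1 M V
            (\<lambda>f x. (kernel_op M (Phat k) ^^ n) f x - rank_one_op M (\<pi>hat k) (\<phi> k) f x)
              \<le> c * r ^ (n + 1))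
       \<and> tv_norm_diff M (\<pi>hat k) \<pi>
           \<le> measure (\<pi>hat k) (space M) * \<bar>1 - (LINT x|\<pi>. \<phi> k x)\<bar>
             + L / (1 - \<delta>) * (2 * c + A / ln (inverse r) * \<bar>ln (\<Delta> k)\<bar>) * \<Delta> k"
proof -
  interpret weighted_space M V
    by unfold_locales (use V_meas V_ge_1 x0 in auto)
  have P_kernel: "P \<in> M \<rightarrow>\<^sub>M subprob_algebra M" by (rule measurable_prob_algebraD[OF P_Markov])
  have P_prob: "prob_space (P x)" if "x \<in> space M" for x
    using measurable_space[OF P_Markov that] by (simp add: space_prob_algebra)
  interpret pi: prob_space \<pi> by (rule pi(1))
  interpret pihat: finite_measure "\<pi>hat k" by (rule pihat(1)[OF k(1)])
  interpret P: spectral_kernel M V P \<delta> L \<pi> "\<lambda>_. 1"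
  proof unfold_locales
    show "(LINT y|P x. 1) = (1::real)" if "x \<in> space M" for x
      using prob_space.prob_space[OF P_prob[OF that]] by simp
    show "(LINT y|\<pi>. 1) = (1::real)" using prob_space.prob_space[OF pi(1)] by simp
  qed (use P_kernel P_drift delta L pi in auto)
  interpret Q: spectral_kernel M V "Phat k" \<delta> L "\<pi>hat k" "\<phi> k"
    by unfold_locales (use Phat_sub_Markov Phat_drift delta L pihat phi_meas phi_nonneg phi_bounded
        phi_invariant phi_normalized k(1) in auto)
  obtain C\<^sub>P where C\<^sub>P: "0 < C\<^sub>P" "P.rate C\<^sub>P \<rho>" using P.V_geom_ergodic_rate[OF P_ergodic] .
  obtain C\<^sub>Q where C\<^sub>Q: "0 < C\<^sub>Q" "Q.rate C\<^sub>Q \<rho>k" using Q.V_geom_ergodic_rate[OF Phat_k_ergodic(1)] .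
  have rates: "0 < \<rho>" "0 < \<rho>k" using P_ergodic Phat_k_ergodic(1) by (auto simp: V_geom_ergodic_def)
  have \<alpha>: "\<delta> \<le> \<alpha>" "0 < \<alpha>" "\<alpha> < r" "\<alpha> < 1" and \<rho>: "\<rho> + \<theta> < r"
    using delta r r_theta theta by (auto simp: \<alpha>_def)

  \<comment> \<open>At \<open>x0\<close>, where \<open>V\<close> takes its minimum 1, the drift condition forces \<open>\<delta> + L\<close> to be at least 1. Hence
     \<open>B \<ge> 1\<close>; with \<open>H \<ge> 1\<close> this makes the argument of the logarithm in \<open>n2\<close> at least 1, so that
     \<open>n1\<close> and \<open>n2\<close> are natural numbers, and makes \<open>\<epsilon>1\<close> smaller than 1.\<close>
  have "1 \<le> \<delta> + L"
  proof -
    interpret px: prob_space "P x0" by (rule P_prob[OF x0(1)])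
    have "1 \<le> (LINT y|P x0. V y)"
      using integral_mono[of "P x0" "\<lambda>_. 1" V] P.integrable_V[OF x0(1)] V_ge_1 P.space_K[OF x0(1)]
        px.prob_space by simp
    then show ?thesis using P.integral_V_le[OF x0(1)] x0(2) by simp
  qed
  then have "1 \<le> L / (1 - \<delta>)" using delta by simp
  moreover have LB: "L / (1 - \<delta>) \<le> B"
    unfolding B_def using \<alpha> delta L by (intro divide_left_mono) auto
  ultimately have B: "1 \<le> B" by simp

  have H: "1 \<le> H"
    unfolding H_def by (rule P.resolvent_bound_lower[OF C\<^sub>P(2) rates(1) \<rho> r_theta(2) theta(1)])

  define m1 where "m1 = nat n1"
  define m2 where "m2 = nat n2"
  have ratio: "1 < r / \<alpha>" using \<alpha> by simp
  have m1: "int m1 = n1" "2 \<le> (r / \<alpha>) ^ m1"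
    unfolding m1_def n1_def using floor_log_exponent[of 2 "r / \<alpha>"] ratio by auto
  have powi_m1: "r powi n1 = r ^ m1" "r powi (- n1) = 1 / r ^ m1"
    unfolding m1(1)[symmetric] by (simp_all add: power_int_minus divide_inverse)
  have "1 \<le> 8 * B * (B + 3) * r powi (- n1) * H"
  proof -
    have "1 \<le> 1 / r ^ m1" using r by (simp add: power_le_one)
    moreover have "1 \<le> 8 * B * (B + 3)" using B mult_mono[of 1 "8 * B" 1 "B + 3"] by simp
    ultimately have "1 * 1 * 1 \<le> (8 * B * (B + 3)) * (1 / r ^ m1) * H"
      using H B r by (intro mult_mono mult_nonneg_nonneg) auto
    then show ?thesis by (simp add: powi_m1)
  qed
  from floor_log_exponent[OF this ratio]
  have m2: "int m2 = n2" "8 * B * (B + 3) * r powi (- n1) * H \<le> (r / \<alpha>) ^ m2"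
    unfolding m2_def n2_def by auto
  have \<epsilon>1_eq: "\<epsilon>1 = r ^ (m1 + m2) / (8 * B * (H * B + inverse (1 - r)))"
    unfolding \<epsilon>1_def m1(1)[symmetric] m2(1)[symmetric] of_nat_add[symmetric] power_int_of_nat ..
  have c_eq: "c = 4 * (B + 1) / (r ^ m1 * (1 - r)) + 1 / (2 * \<epsilon>1)"
    by (simp add: c_def powi_m1)
  have n1_bound: "(\<alpha> / r) ^ m1 \<le> 1 / 2"
    using m1(2) \<alpha> r by (simp add: power_divide field_simps)
  have n2_bound: "8 * B * (B + 3) * H * (\<alpha> / r) ^ m2 \<le> r ^ m1"
    using m2(2) \<alpha> r unfolding powi_m1 by (simp add: power_divide field_simps)
  have denominator: "1 \<le> H * B" "0 < inverse (1 - r)"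
    using mult_mono[of 1 H 1 B] H B r by auto
  have \<epsilon>1: "0 < \<epsilon>1" "\<epsilon>1 < 1"
  proof -
    have D: "1 < 8 * B * (H * B + inverse (1 - r))"
      using mult_mono[of 1 B 1 "H * B + inverse (1 - r)"] denominator B by simp
    then show "0 < \<epsilon>1" unfolding \<epsilon>1_eq using r by (intro divide_pos_pos) auto
    have "r ^ (m1 + m2) \<le> 1" using r by (intro power_le_one) auto
    then show "\<epsilon>1 < 1" unfolding \<epsilon>1_eq using D by (simp add: divide_less_eq)
  qed
  have c: "0 \<le> c" unfolding c_eq using B r \<epsilon>1 by (intro add_nonneg_nonneg divide_nonneg_nonneg mult_nonneg_nonneg) auto

  have close: "(\<lambda>x. Q.T f x - P.T f x) \<in> wball M V (\<Delta> k)" if f: "f \<in> wball M (\<lambda>_. 1) 1" for f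
  proof -
    have "(\<lambda>x. Q.T f x - P.T f x)
        \<in> wball M V (opnorm01 M V (\<lambda>f x. Q.T f x - P.T f x) * 1)"
    proof (rule opnorm_wball[OF weight_1 weight_V _ _ f])
      show "(\<lambda>x. Q.T g x - P.T g x) \<in> wball M V (1 + 1)" if "g \<in> wball M (\<lambda>_. 1) 1" for g
        using P.T_wball_1[OF that] Q.T_wball_1[OF that] by (intro wball_diff wball_weight_V[OF _ weight_1])
    qed (simp add: P.T_scale Q.T_scale right_diff_distrib)
    then show ?thesis by (simp add: \<Delta>_def)
  qed
  have \<Delta>: "0 \<le> \<Delta> k" "\<Delta> k < 1"
    using wball_nonneg[OF close[OF indicator_in_wball]] k(2) \<epsilon>1 by auto

  have resolvent_Q: "Q.dual_resolvent_bound c z" if z: "r < cmod z" "cmod z < 1 - \<theta>" for z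
    unfolding Q.dual_resolvent_bound_def
  proof (intro allI impI)
    fix m \<kappa> f D
    assume m: "bounded_functional M V m"
      and \<kappa>: "\<forall>f D. f \<in> wball M V D \<longrightarrow> cmod (m (\<lambda>x. z * f x - Q.T f x)) \<le> \<kappa> * D"
      and f: "f \<in> wball M V D"
    have z': "z \<notin> spectral_nbhd M V r \<theta> P.T"
      by (rule P.not_in_spectral_nbhd[OF C\<^sub>P(2) rates(1) z \<rho>])
    have "\<rho> < r" "\<rho> < cmod z" "z \<noteq> 1" using z \<rho> theta by auto
    note z'' = this
    show "cmod (m f) \<le> c * \<kappa> * D"
      unfolding c_eq
    proof (rule functional_perturbation_bound[OF m P.drift_kernel_axioms Q.drift_kernel_axioms r z(1)
          _ _ close LB \<alpha>(1) _ n1_bound n2_bound \<epsilon>1_eq k(2) _ f])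
      fix g assume g: "g \<in> wball M (\<lambda>_. 1) 1"
      have gV: "g \<in> wball M V 1" by (rule wball_weight_V[OF g weight_1])
      have "P.resolvent_series z g \<in> wball M V (H * 1)"
        unfolding H_def by (rule P.resolvent_bound[OF C\<^sub>P(2) rates(1) z''(1) theta(1) z' gV])
      then show "\<exists>u. u \<in> wball M V H \<and> (\<lambda>x. z * u x - P.T u x) = g"
        using P.resolvent_series_right_inverse[OF C\<^sub>P(2) rates(1) wball_V_in_wspace[OF gV] z''(2,3)] by auto
    qed (use z theta H \<kappa> in auto)
  qed
  have decay: "Q.dev n f \<in> wball M V (c * r ^ (n + 1) * D)" if "f \<in> wball M V D" for n f D
    by (rule Q.uniform_rate[OF C\<^sub>Q(2) less_imp_le[OF C\<^sub>Q(1)] rates(2) Phat_k_ergodic(2) r(1) r_theta(2) _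
          resolvent_Q that]) (use theta in auto)

  have "opnorm1 M V (\<lambda>f x. (Q.T ^^ n) f x - rank_one_op M (\<pi>hat k) (\<phi> k) f x) \<le> c * r ^ (n + 1)" for n
    using decay[of _ 1 n] by (intro opnorm_le) (auto simp: Q.dev_def)
  moreover have "tv_norm_diff M (\<pi>hat k) \<pi>
      \<le> measure (\<pi>hat k) (space M) * \<bar>1 - (LINT x|\<pi>. \<phi> k x)\<bar>
        + L / (1 - \<delta>) * (2 * c + A / ln (inverse r) * \<bar>ln (\<Delta> k)\<bar>) * \<Delta> k"
    unfolding tv_norm_diff_def
  proof (rule cSup_least)
    show "{cmod ((LINT x|\<pi>hat k. f x) - (LINT x|\<pi>. f x)) | f. f \<in> wspace M (\<lambda>_. 1) \<and> wnorm M (\<lambda>_. 1) f \<le> 1} \<noteq> {}"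
      using unit_ball_eq[OF weight_1, of 1] indicator_in_wball by auto
    fix y
    assume "y \<in> {cmod ((LINT x|\<pi>hat k. f x) - (LINT x|\<pi>. f x)) | f. f \<in> wspace M (\<lambda>_. 1) \<and> wnorm M (\<lambda>_. 1) f \<le> 1}"
    then obtain f where f: "f \<in> wball M (\<lambda>_. 1) 1" and y: "y = cmod ((LINT x|\<pi>hat k. f x) - (LINT x|\<pi>. f x))"
      using unit_ball_eq[OF weight_1, of 1] by blast
    let ?a = "measure (\<pi>hat k) (space M) * \<bar>1 - (LINT x|\<pi>. \<phi> k x)\<bar>"
    have ln_r: "0 < ln (inverse r)" using r by (simp add: ln_inverse)
    have v: "0 \<le> L / (1 - \<delta>)" using L delta by simp
    have "y \<le> ?a + L / (1 - \<delta>) * (c * r ^ (n + 1) + real n * \<Delta> k)" for n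
      unfolding y
      by (rule invariant_integral_perturbation[OF P.invariant_kernel_axioms pi(1) Q.spectral_kernel_axioms close _ f])
        (use decay[of _ 1 n] in auto)
    then have "y \<le> ?a + L / (1 - \<delta>) * (c + \<bar>ln (\<Delta> k)\<bar> / ln (inverse r)) * \<Delta> k"
      by (rule bound_at_optimal_time[OF r \<Delta> c v])
    also have "\<dots> \<le> ?a + L / (1 - \<delta>) * (2 * c + A / ln (inverse r) * \<bar>ln (\<Delta> k)\<bar>) * \<Delta> k"
    proof (intro add_left_mono mult_right_mono mult_left_mono add_mono)
      have "1 * (\<bar>ln (\<Delta> k)\<bar> / ln (inverse r)) \<le> A * (\<bar>ln (\<Delta> k)\<bar> / ln (inverse r))"
        using v ln_r by (intro mult_right_mono) (auto simp: A_def)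
      then show "\<bar>ln (\<Delta> k)\<bar> / ln (inverse r) \<le> A / ln (inverse r) * \<bar>ln (\<Delta> k)\<bar>" by simp
    qed (use c v \<Delta> in auto)
    finally show "y \<le> ?a + L / (1 - \<delta>) * (2 * c + A / ln (inverse r) * \<bar>ln (\<Delta> k)\<bar>) * \<Delta> k" .
  qed
  ultimately show ?thesis by blast
qed

end
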